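(* Let $M\subset\mathbb{A}^3$ be the affine Markoff surface $x^2+y^2+z^2=xyz$ and let $f=\phi_1\circ\phi_2$, where $\phi_1(x,y,z)=(yz-x,\,y,\,z)$ and $\phi_2(x,y,z)=(x,\,xz-y,\,z)$. Let the forbidden set be $\mathcal{F}_2 = \{(x,y,z)\in M : z^2-1=0\} \cup \{(0,0,0)\}$. Then the system $(M,f,\mathcal{F}_2)$ is not strongly residually periodic over $\mathbb{Q}$: there is no pair consisting of a positive integer $B$ and a finite set $S$ of primes such that for every prime $p\notin S$ there exists a point $P=(x,y,z)\in M(\mathbb{F}_p)$ with $z^2\neq 1$ in $\mathbb{F}_p$, $P\neq(0,0,0)$, and $f_p^n(P)=P$ for some $1\le n\le B$.
   Context: For a prime $p$, $M(\mathbb{F}_p)$ denotes the set of $(x,y,z)\in\mathbb{F}_p^3$ satisfying $x^2+y^2+z^2=xyz$ in $\mathbb{F}_p$, and $f_p$ denotes the map on $M(\mathbb{F}_p)$ given by the same polynomial formulas as $f$ reduced modulo $p$, i.e. $f_p(x,y,z) = \big(z(xz-y)-x,\; xz-y,\; z\big)$. *)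

theory Defs
  imports "HOL-Number_Theory.Residues"
begin

text \<open>
  Everything below is given by polynomials with integer coefficients, so the surface, the maps and
  the forbidden set are defined by their points over an arbitrary commutative ring \<open>R\<close>. Taking
  \<open>R = residue_ring (int p)\<close>, the field \<open>{0..p-1}\<close> with arithmetic modulo \<open>p\<close>, gives the reductions
  modulo \<open>p\<close>.
\<close>

definition markoff_surface :: "('a, 'b) ring_scheme \<Rightarrow> ('a \<times> 'a \<times> 'a) set" where
  "markoff_surface R =
    {(x, y, z). x \<in> carrier R \<and> y \<in> carrier R \<and> z \<in> carrier R \<and>
       x [^]\<^bsub>R\<^esub> (2::nat) \<oplus>\<^bsub>R\<^esub> y [^]\<^bsub>R\<^esub> (2::nat) \<oplus>\<^bsub>R\<^esub> z [^]\<^bsub>R\<^esub> (2::nat) = x \<otimes>\<^bsub>R\<^esub> y \<otimes>\<^bsub>R\<^esub> z}"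

definition phi1 :: "('a, 'b) ring_scheme \<Rightarrow> 'a \<times> 'a \<times> 'a \<Rightarrow> 'a \<times> 'a \<times> 'a" where
  "phi1 R = (\<lambda>(x, y, z). (y \<otimes>\<^bsub>R\<^esub> z \<ominus>\<^bsub>R\<^esub> x, y, z))"

definition phi2 :: "('a, 'b) ring_scheme \<Rightarrow> 'a \<times> 'a \<times> 'a \<Rightarrow> 'a \<times> 'a \<times> 'a" where
  "phi2 R = (\<lambda>(x, y, z). (x, x \<otimes>\<^bsub>R\<^esub> z \<ominus>\<^bsub>R\<^esub> y, z))"

definition markoff_map :: "('a, 'b) ring_scheme \<Rightarrow> 'a \<times> 'a \<times> 'a \<Rightarrow> 'a \<times> 'a \<times> 'a" where
  "markoff_map R = phi1 R \<circ> phi2 R"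

definition forbidden_set2 :: "('a, 'b) ring_scheme \<Rightarrow> ('a \<times> 'a \<times> 'a) set" where
  "forbidden_set2 R =
    {(x, y, z) \<in> markoff_surface R. z [^]\<^bsub>R\<^esub> (2::nat) \<ominus>\<^bsub>R\<^esub> \<one>\<^bsub>R\<^esub> = \<zero>\<^bsub>R\<^esub>} \<union>
    {(\<zero>\<^bsub>R\<^esub>, \<zero>\<^bsub>R\<^esub>, \<zero>\<^bsub>R\<^esub>)}"

text \<open>
  The base field is the field of rational numbers. A system \<open>(X, f, F)\<close> enters through its points
  over rings carried by a set of integers, of which only the prime fields \<open>residue_ring (int p)\<close>
  are used.
\<close>

definition strongly_residually_periodic ::
  "(int ring \<Rightarrow> 'c set) \<Rightarrow> (int ring \<Rightarrow> 'c \<Rightarrow> 'c) \<Rightarrow> (int ring \<Rightarrow> 'c set) \<Rightarrow> bool" where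
  "strongly_residually_periodic X f F \<longleftrightarrow>
    (\<exists>(B::nat) (S::nat set). B > 0 \<and> finite S \<and> (\<forall>q\<in>S. prime q) \<and>
      (\<forall>p::nat. prime p \<and> p \<notin> S \<longrightarrow>
        (\<exists>P \<in> X (residue_ring (int p)) - F (residue_ring (int p)).
          \<exists>n. 1 \<le> n \<and> n \<le> B \<and> (f (residue_ring (int p)) ^^ n) P = P)))"

end

theory Submission
  imports Defs "HOL-Number_Theory.Number_Theory" "HOL-Computational_Algebra.Squarefree"
begin

text \<open>
  On a slice of constant \<open>z\<close> the map is two steps of the linear recurrence
  \<open>s (k + 2) = z * s (k + 1) - s k\<close>, so a point of period \<open>n\<close> gives a sequence modulo \<open>p\<close> with
  period \<open>2 * n\<close>. By Lucas's theorem its period also divides \<open>p - 1\<close> or \<open>p + 1\<close>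
  (or \<open>2 * p\<close> when \<open>z\<^sup>2 = 4\<close>). Choose \<open>p\<close> with \<open>p \<equiv> 67 (mod 72)\<close> and \<open>p \<equiv> 2 (mod q)\<close> for all primes
  \<open>5 \<le> q \<le> 2 * B\<close>; then every divisor of \<open>p - 1\<close> or \<open>p + 1\<close> that is at most \<open>2 * B\<close> divides \<open>6\<close> or \<open>4\<close>,
  respectively. Period \<open>6\<close> forces \<open>(z\<^sup>2 - 4) * (z\<^sup>2 - 1)\<^sup>2 = 0\<close>, and period \<open>4\<close> forces
  \<open>z\<^sup>2 * (z\<^sup>2 - 4) = 0\<close>. Here \<open>z\<^sup>2 = 4\<close> is incompatible with periodicity
  on the surface, \<open>z\<^sup>2 = 1\<close> is forbidden, and
  \<open>z = 0\<close> leaves only the origin since \<open>-1\<close> is not a square modulo \<open>p\<close>.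

  Since \<open>p\<close> must avoid both \<open>1\<close> and \<open>-1\<close> modulo many primes, its existence needs Dirichlet's theorem.
  This is proved by Mertens-style estimates of \<open>\<Sum>n\<le>X. \<chi> n * mangoldt n / n\<close>: the sum is bounded if
  \<open>L(1,\<chi>) \<noteq> 0\<close> and equals \<open>- ln X + O(1)\<close> otherwise. Positivity of the sum over all characters allows at most
  one vanishing \<open>L(1,\<chi>)\<close>, so such a \<open>\<chi>\<close> is real, and Monsky's argument excludes real characters.
\<close>

section \<open>Elementary estimates for arithmetic functions\<close>

text \<open>Abel summation: the boundary terms contribute at most \<open>C * b k + C * b m\<close>
  and the telescoping remainder at most \<open>C * (b m - b k)\<close>. The bound is uniform in
  \<open>k\<close>, so it controls tails of series whose coefficients have bounded partial
  sums.\<close>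

lemma norm_sum_mult_antimono_le:
  fixes f :: "nat \<Rightarrow> complex" and b :: "nat \<Rightarrow> real"
  assumes F: "\<And>k. norm (\<Sum>n<k. f n) \<le> C"
    and b: "\<And>n. m \<le> n \<Longrightarrow> b (Suc n) \<le> b n" "\<And>n. m \<le> n \<Longrightarrow> 0 \<le> b n"
  shows   "norm (\<Sum>n\<in>{m..<k}. f n * b n) \<le> 2 * C * b m"
proof -
  have C: "C \<ge> 0" using F[of 0] by simp
  show ?thesis
  proof (cases "m \<le> k")
    case True
    define F where "F k = (\<Sum>n<k. f n)" for k
    have eq: "(\<Sum>n\<in>{m..<k}. f n * b n) =
            F k * b k - F m * b m + (\<Sum>n\<in>{m..<k}. F (Suc n) * of_real (b n - b (Suc n)))"
      using True by (induction k rule: dec_induct) (auto simp: F_def algebra_simps)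
    have tele: "(\<Sum>n\<in>{m..<k}. b n - b (Suc n)) = b m - b k"
      using True by (induction k rule: dec_induct) auto
    have "norm (\<Sum>n\<in>{m..<k}. F (Suc n) * of_real (b n - b (Suc n))) \<le>
            (\<Sum>n\<in>{m..<k}. C * (b n - b (Suc n)))"
    proof (intro sum_norm_le)
      fix n assume "n \<in> {m..<k}"
      hence "b (Suc n) \<le> b n" using b(1) by simp
      moreover have "norm (F (Suc n)) \<le> C" unfolding F_def by (rule F)
      ultimately show "norm (F (Suc n) * of_real (b n - b (Suc n))) \<le> C * (b n - b (Suc n))"
        unfolding norm_mult norm_of_real using C by (intro mult_mono) auto
    qed
    also have "\<dots> = C * (b m - b k)" by (simp add: tele flip: sum_distrib_left)
    finally have 1: "norm (\<Sum>n\<in>{m..<k}. F (Suc n) * of_real (b n - b (Suc n))) \<le> C * (b m - b k)" .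
    have 2: "norm (F j * b j) \<le> C * b j" if "m \<le> j" for j
      using F[of j] b(2)[OF that] by (simp add: norm_mult F_def mult_right_mono)
    have "norm (F k * b k - F m * b m) \<le> C * b k + C * b m"
      using norm_triangle_ineq4[of "F k * b k" "F m * b m"] 2[OF True] 2[of m] by simp
    with 1 have "norm (\<Sum>n\<in>{m..<k}. f n * b n) \<le> C * b k + C * b m + C * (b m - b k)"
      unfolding eq by (meson add_mono norm_triangle_le)
    thus ?thesis by (simp add: algebra_simps)
  qed (use C b(2)[of m] in auto)
qed

text \<open>Both sides run over the pairs \<open>(d, m)\<close> of positive integers with
  \<open>d * m \<le> X\<close>, where \<open>n = d * m\<close>.\<close>

lemma sum_divisors_swap:
  fixes F :: "nat \<Rightarrow> nat \<Rightarrow> 'a :: comm_monoid_add"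
  shows "(\<Sum>n=1..X. \<Sum>d | d dvd n. F d (n div d)) = (\<Sum>d=1..X. \<Sum>m=1..X div d. F d m)"
proof -
  have "(\<Sum>n=1..X. \<Sum>d | d dvd n. F d (n div d)) =
          (\<Sum>(n, d)\<in>(SIGMA n:{1..X}. {d. d dvd n}). F d (n div d))"
    by (subst sum.Sigma) auto
  also have "\<dots> = (\<Sum>(d, m)\<in>(SIGMA d:{1..X}. {1..X div d}). F d m)"
    by (rule sum.reindex_bij_witness[where i = "\<lambda>(d, m). (d * m, d)" and j = "\<lambda>(n, d). (d, n div d)"])
       (auto simp: div_le_mono less_eq_div_iff_mult_less_eq Suc_le_eq mult.commute
             intro: dvd_pos_nat order.trans[OF dvd_imp_le] intro!: Nat.gr0I)
  also have "\<dots> = (\<Sum>d=1..X. \<Sum>m=1..X div d. F d m)"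
    by (subst sum.Sigma) auto
  finally show ?thesis .
qed

section \<open>The Moebius function and its inversion formula for the logarithm\<close>

definition moebius :: "nat \<Rightarrow> real" where
  "moebius n = (if squarefree n then (-1) ^ card (prime_factors n) else 0)"

lemma abs_moebius_le: "\<bar>moebius n\<bar> \<le> 1"
  by (simp add: moebius_def power_abs)

lemma moebius_mult_prime:
  assumes "prime p" "\<not> p dvd d"
  shows   "moebius (p * d) = - moebius d"
proof (cases "squarefree d")
  case True
  hence "d \<noteq> 0" by (metis not_squarefree_0)
  have "coprime p d" using assms by (simp add: prime_imp_coprime)
  hence "squarefree (p * d)" using assms True by (simp add: squarefree_mult_coprime squarefree_prime)
  moreover have "prime_factors (p * d) = insert p (prime_factors d)"
    using assms \<open>d \<noteq> 0\<close> by (auto simp: prime_factors_product prime_prime_factors)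
  moreover have "p \<notin> prime_factors d" using assms by auto
  ultimately show ?thesis using True by (simp add: moebius_def)
next
  case False
  hence "\<not> squarefree (p * d)" using squarefree_multD(2) by blast
  with False show ?thesis by (simp add: moebius_def)
qed

text \<open>For a prime \<open>p\<close> dividing \<open>n\<close>, multiplication by
  \<open>p\<close> pairs the divisors prime to \<open>p\<close> with those divisible by
  \<open>p\<close> exactly once. The two terms of each pair cancel, and every other divisor contains
  \<open>p ^ 2\<close>.\<close>

lemma sum_moebius:
  assumes "n > 0"
  shows   "(\<Sum>d | d dvd n. moebius d) = of_bool (n = 1)"
proof (cases "n = 1")
  case True
  thus ?thesis by (simp add: moebius_def)
next
  case False
  then obtain p where p: "prime p" "p dvd n" using prime_factor_nat by blast
  have fin: "finite {d. d dvd n}" using assms by simp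
  let ?A = "{d. d dvd n \<and> \<not> p dvd d}"
  let ?B = "{d. d dvd n \<and> p dvd d \<and> \<not> p ^ 2 dvd d}"
  have nz: "p \<noteq> 0" using p by auto
  have B: "?B = (\<lambda>d. p * d) ` ?A"
  proof safe
    fix d assume d: "d dvd n" "p dvd d" "\<not> p ^ 2 dvd d"
    then obtain e where e: "d = p * e" by auto
    have "\<not> p dvd e" using d(3) by (auto simp: e power2_eq_square)
    moreover have "e dvd n" using d(1) e by (meson dvd_mult_right)
    ultimately show "d \<in> (*) p ` ?A" using e by auto
  next
    fix d assume d: "d dvd n" "\<not> p dvd d"
    have "coprime p d" using p d by (simp add: prime_imp_coprime)
    with p d show "p * d dvd n" by (simp add: divides_mult)
    show "p dvd p * d" by simp
    assume "p ^ 2 dvd p * d"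
    with d nz show False by (simp add: power2_eq_square)
  qed
  have "(\<Sum>d | d dvd n. moebius d) = (\<Sum>d\<in>?A \<union> ?B. moebius d)"
  proof (rule sum.mono_neutral_right[OF fin])
    show "\<forall>d\<in>{d. d dvd n} - (?A \<union> ?B). moebius d = 0"
      using p by (auto simp: moebius_def squarefree_def)
  qed auto
  also have "\<dots> = sum moebius ?A + sum moebius ?B"
    using fin by (intro sum.union_disjoint) (auto intro: finite_subset[OF _ fin])
  also have "sum moebius ?B = (\<Sum>d\<in>?A. moebius (p * d))"
    unfolding B using nz by (subst sum.reindex) (auto simp: inj_on_def)
  also have "\<dots> = - sum moebius ?A"
    using p(1) by (simp add: moebius_mult_prime sum_negf)
  finally show ?thesis using False by simp
qed

text \<open>Moebius inversion of \<open>ln n = (\<Sum>d | d dvd n. mangoldt d)\<close>: after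
  exchanging the sums over \<open>d * k dvd n\<close>, the inner Moebius sum over the divisors of
  \<open>n div k\<close> survives only for \<open>k = n\<close>.\<close>

lemma sum_moebius_ln:
  assumes "n > 0"
  shows   "(\<Sum>d | d dvd n. moebius d * ln (real n / real d)) = mangoldt n"
proof -
  have ln: "ln (real n / real d) = (\<Sum>k | k dvd n div d. mangoldt k)" if "d dvd n" for d
  proof -
    have "n div d > 0" using that assms by (auto elim: dvdE)
    thus ?thesis using that mangoldt_sum[of "n div d", where ?'a = real] by (simp add: real_of_nat_div)
  qed
  have *: "a dvd n \<and> b dvd n div a \<longleftrightarrow> a * b dvd n" for a b
    using assms by (cases "a = 0") (auto elim!: dvdE simp: mult.assoc)
  have *: "a dvd n \<and> b dvd n div a \<longleftrightarrow> b dvd n \<and> a dvd n div b" for a b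
    unfolding * by (simp add: mult.commute)
  have "(\<Sum>d | d dvd n. moebius d * ln (real n / real d)) =
        (\<Sum>d | d dvd n. \<Sum>k | k dvd n div d. moebius d * mangoldt k)"
    by (intro sum.cong refl) (auto simp: ln sum_distrib_left)
  also have "\<dots> = (\<Sum>(d, k)\<in>(SIGMA d:{d. d dvd n}. {k. k dvd n div d}). moebius d * mangoldt k)"
    using assms by (subst sum.Sigma) (auto simp: dvd_div_eq_0_iff)
  also have "\<dots> = (\<Sum>(k, d)\<in>(SIGMA k:{k. k dvd n}. {d. d dvd n div k}). moebius d * mangoldt k)"
    by (rule sum.reindex_bij_witness[where i = prod.swap and j = prod.swap])
       (auto simp: *)
  also have "\<dots> = (\<Sum>k | k dvd n. \<Sum>d | d dvd n div k. moebius d * mangoldt k)"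
    using assms by (subst sum.Sigma) (auto simp: dvd_div_eq_0_iff)
  also have "\<dots> = (\<Sum>k | k dvd n. of_bool (k = n) * mangoldt k)"
  proof (intro sum.cong refl)
    fix k assume "k \<in> {k. k dvd n}"
    hence k: "n div k > 0" "n div k = 1 \<longleftrightarrow> k = n" using assms by (auto simp: dvd_div_eq_0_iff elim!: dvdE)
    show "(\<Sum>d | d dvd n div k. moebius d * mangoldt k) = of_bool (k = n) * mangoldt k"
      unfolding sum_distrib_right[symmetric] sum_moebius[OF k(1)] k(2) ..
  qed
  also have "\<dots> = (\<Sum>k\<in>{n}. mangoldt k)"
    using assms by (intro sum.mono_neutral_cong_right) auto
  finally show ?thesis by simp
qed

section \<open>Legendre's formula for factorials and the estimates of Chebyshev and Mertens\<close>

lemma ln_fact_eq_sum_mangoldt: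
  "ln (fact n) = (\<Sum>d=1..n. mangoldt d * real (n div d))"
proof -
  have "ln (fact n :: real) = (\<Sum>k=1..n. ln (real k))"
    by (induction n) (auto simp: ln_mult simp del: of_nat_Suc)
  also have "\<dots> = (\<Sum>k=1..n. \<Sum>d | d dvd k. mangoldt d)"
    using mangoldt_sum[where ?'a = real] by (intro sum.cong) auto
  also have "\<dots> = (\<Sum>d=1..n. \<Sum>m=1..n div d. mangoldt d)"
    by (rule sum_divisors_swap)
  finally show ?thesis by (simp add: mult.commute)
qed

lemma ln_Suc_diff_le:
  assumes "n > 0"
  shows   "ln (real (Suc n)) - ln (real n) \<le> 1 / n"
proof -
  have "ln (real (Suc n)) - ln n = ln (real (Suc n) / n)"
    using assms by (subst ln_div) auto
  also have "real (Suc n) / n = 1 + 1 / n" using assms by (simp add: field_simps)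
  also have "ln \<dots> \<le> 1 / n" by (intro ln_add_one_self_le_self) auto
  finally show ?thesis .
qed

lemma ln_fact_ge: "n > 0 \<Longrightarrow> ln (fact n) \<ge> real n * ln n - n"
proof (induction n rule: nat_induct_non_zero)
  case (Suc n)
  have "real n * (ln (real (Suc n)) - ln n) \<le> 1"
    using ln_Suc_diff_le[of n] Suc by (simp add: field_simps)
  moreover have "ln (fact (Suc n) :: real) = ln (fact n) + ln (real (Suc n))"
    by (simp add: ln_mult add.commute del: of_nat_Suc)
  ultimately show ?case using Suc.IH by (simp add: algebra_simps)
qed auto

lemma ln_fact_le: "ln (fact n) \<le> real n * ln n"
proof (cases "n = 0")
  case False
  have "ln (fact n) \<le> ln (real n ^ n)"
    using False fact_le_power[of n, where ?'a = real] by (intro ln_mono) auto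
  thus ?thesis using False by (simp add: ln_realpow)
qed auto

text \<open>Chebyshev's argument: the weight \<open>2 * n div d - 2 * (n div d)\<close> is never
  negative and is at least 1 for \<open>n < d \<le> 2 * n\<close>, while by Legendre's formula the
  weighted sum is the logarithm of the central binomial coefficient, at most
  \<open>ln (2 ^ (2 * n))\<close>.\<close>

lemma sum_mangoldt_double:
  "(\<Sum>d=1..2*n. mangoldt d) \<le> (\<Sum>d=1..n. mangoldt d) + 2 * real n"
proof -
  have "(\<Sum>d=n+1..2*n. mangoldt d :: real) \<le>
          (\<Sum>d=n+1..2*n. mangoldt d * (real (2 * n div d) - 2 * real (n div d)))"
  proof (intro sum_mono)
    fix d assume d: "d \<in> {n+1..2*n}"
    hence "2 * n div d \<ge> 1" "n div d = 0" by (auto simp: less_eq_div_iff_mult_less_eq)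
    thus "(mangoldt d :: real) \<le> mangoldt d * (real (2 * n div d) - 2 * real (n div d))"
      using mult_left_mono[of 1 "real (2 * n div d)" "mangoldt d"] mangoldt_nonneg[of d] by simp
  qed
  also have "\<dots> \<le> (\<Sum>d=1..2*n. mangoldt d * (real (2 * n div d) - 2 * real (n div d)))"
  proof (intro sum_mono2)
    fix d assume "d \<in> {1..2*n} - {n+1..2*n}"
    have "2 * (n div d) \<le> 2 * n div d"
      by (metis div_mult1_eq le_add1)
    hence "2 * real (n div d) \<le> real (2 * n div d)" by (metis of_nat_le_iff of_nat_mult of_nat_numeral)
    thus "0 \<le> mangoldt d * (real (2 * n div d) - 2 * real (n div d))"
      by (intro mult_nonneg_nonneg mangoldt_nonneg) simp
  qed auto
  also have "\<dots> = ln (fact (2 * n)) - 2 * (\<Sum>d=1..2*n. mangoldt d * real (n div d))"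
    unfolding ln_fact_eq_sum_mangoldt
    by (simp add: right_diff_distrib sum_subtractf sum_distrib_left mult_ac)
  also have "(\<Sum>d=1..2*n. mangoldt d * real (n div d)) = (\<Sum>d=1..n. mangoldt d * real (n div d))"
    by (rule sum.mono_neutral_right) auto
  also have "\<dots> = ln (fact n)" by (simp add: ln_fact_eq_sum_mangoldt)
  also have "ln (fact (2 * n) :: real) - 2 * ln (fact n) = ln (real ((2 * n) choose n))"
  proof -
    have "real ((2 * n) choose n) = fact (2 * n) / (fact n * fact n)"
      using binomial_fact[of n "2 * n", where ?'a = real] by (simp add: mult_2)
    thus ?thesis by (simp add: ln_div ln_mult)
  qed
  also have "\<dots> \<le> ln (2 ^ (2 * n))"
    using binomial_le_pow2[of "2 * n" n] by (intro ln_mono) (auto simp flip: of_nat_le_iff simp: zero_less_binomial)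
  also have "\<dots> \<le> 2 * real n"
    using mult_left_mono[of "ln 2" 1 "2 * real n"] ln_le_minus_one[of 2] by (simp add: ln_realpow)
  finally have "(\<Sum>d=n+1..2*n. mangoldt d) \<le> 2 * real n" .
  moreover have "(\<Sum>d=1..2*n. mangoldt d :: real) = (\<Sum>d=1..n. mangoldt d) + (\<Sum>d=n+1..2*n. mangoldt d)"
    by (subst sum.union_disjoint[symmetric]) (auto intro!: sum.cong)
  ultimately show ?thesis by simp
qed

lemma sum_mangoldt_le: "(\<Sum>d=1..n. mangoldt d) \<le> 4 * real n"
proof (induction n rule: less_induct)
  case (less n)
  consider "n = 0" | "n = 1" | "n = 2" | "n > 2" by linarith
  thus ?case
  proof cases
    assume n: "n = 2"
    have "{1..2} = {1, 2::nat}" by auto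
    thus ?thesis using ln_le_minus_one[of 2] by (simp add: n)
  next
    assume n: "n > 2"
    \<comment> \<open>Rounding the half up gives \<open>n \<le> 2 * k\<close>; the induction
      hypothesis then yields \<open>6 * k \<le> 3 * n + 3\<close>, which is at most
      \<open>4 * n\<close> exactly from \<open>n = 3\<close> on.\<close>
    define k where "k = (n + 1) div 2"
    have k: "k < n" "n \<le> 2 * k" "2 * k \<le> n + 1" using n by (auto simp: k_def)
    have "(\<Sum>d=1..n. mangoldt d :: real) \<le> (\<Sum>d=1..2*k. mangoldt d)"
      using k by (intro sum_mono2) (auto simp: mangoldt_nonneg)
    also have "\<dots> \<le> (\<Sum>d=1..k. mangoldt d) + 2 * real k" by (rule sum_mangoldt_double)
    also have "\<dots> \<le> 4 * real k + 2 * real k" using less.IH[OF k(1)] by simp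
    also have "\<dots> \<le> 4 * real n" using k n by linarith
    finally show ?thesis .
  qed auto
qed

lemma real_div_le_Suc: "real X / real d \<le> real (X div d) + 1"
proof (cases "d = 0")
  case False
  hence "X < d * (X div d + 1)" using dividend_less_times_div[of d X] by (simp add: algebra_simps)
  hence "real X \<le> real (d * (X div d + 1))" by linarith
  with False show ?thesis by (simp add: field_simps)
qed auto

text \<open>Mertens' estimate: replace \<open>X div d\<close> by \<open>X / d\<close> in Legendre's
  formula for \<open>ln (fact X)\<close> and divide by \<open>X\<close>. Rounding costs less than
  one per term, hence at most the Chebyshev sum.\<close>

lemma sum_mangoldt_over_n:
  assumes "X > 0"
  shows   "(\<Sum>d=1..X. mangoldt d / d) \<ge> ln X - 1"
    and   "(\<Sum>d=1..X. mangoldt d / d) \<le> ln X + 4"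
proof -
  have "real X * ln X - X \<le> (\<Sum>d=1..X. mangoldt d * real (X div d))"
    using ln_fact_ge[OF assms] by (simp add: ln_fact_eq_sum_mangoldt)
  also have "\<dots> \<le> (\<Sum>d=1..X. mangoldt d * (X / d))"
    by (intro sum_mono mult_left_mono mangoldt_nonneg of_nat_div_le_of_nat)
  also have "\<dots> = X * (\<Sum>d=1..X. mangoldt d / d)" by (simp add: sum_distrib_left mult_ac)
  finally have "real X * (ln X - 1) \<le> X * (\<Sum>d=1..X. mangoldt d / d)" by (simp add: algebra_simps)
  thus "(\<Sum>d=1..X. mangoldt d / d) \<ge> ln X - 1" using assms by simp
next
  have "X * (\<Sum>d=1..X. mangoldt d / d) = (\<Sum>d=1..X. mangoldt d * (X / d))"
    by (simp add: sum_distrib_left mult_ac)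
  also have "\<dots> \<le> (\<Sum>d=1..X. mangoldt d * (real (X div d) + 1))"
    by (intro sum_mono mult_left_mono mangoldt_nonneg) (rule real_div_le_Suc)
  also have "\<dots> = ln (fact X) + (\<Sum>d=1..X. mangoldt d)"
    by (simp add: ln_fact_eq_sum_mangoldt algebra_simps sum.distrib)
  also have "\<dots> \<le> X * ln X + 4 * X" using ln_fact_le[of X] sum_mangoldt_le[of X] by simp
  finally have "X * (\<Sum>d=1..X. mangoldt d / d) \<le> X * (ln X + 4)" by (simp add: algebra_simps)
  thus "(\<Sum>d=1..X. mangoldt d / d) \<le> ln X + 4" using assms by simp
qed

section \<open>Contributions of proper prime powers and of numbers not prime to the modulus\<close>

lemma sum_geometric_tail_le:
  fixes r :: real
  assumes "0 \<le> r" "r \<le> 1 / 2"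
  shows   "(\<Sum>k=j..X. r ^ k) \<le> 2 * r ^ j"
proof (cases "j \<le> X")
  case True
  have "(\<Sum>k=j..X. r ^ k) = (r ^ j - r ^ Suc X) / (1 - r)"
    using assms True by (simp add: sum_gp)
  also have "\<dots> \<le> r ^ j / (1 - r)" using assms by (intro divide_right_mono) auto
  also have "\<dots> \<le> r ^ j / (1 / 2)" using assms by (intro divide_left_mono) auto
  finally show ?thesis by simp
qed (use assms in auto)

text \<open>Only powers \<open>p ^ k\<close> with \<open>k \<ge> j\<close> contribute, and their
  reciprocals form a geometric series of ratio at most one half. The case \<open>j = 2\<close>
  serves for non-primes, \<open>j = 1\<close> for numbers sharing a factor with the modulus.\<close>

lemma sum_mangoldt_prime_powers_le:
  assumes P: "finite P" "\<And>p. p \<in> P \<Longrightarrow> prime p"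
    and A: "finite A" "\<And>n. n \<in> A \<Longrightarrow> mangoldt n \<noteq> (0::real) \<Longrightarrow> \<exists>p\<in>P. \<exists>k\<in>{j..X}. n = p ^ k"
    and j: "j \<ge> 1"
  shows "(\<Sum>n\<in>A. mangoldt n / n) \<le> (\<Sum>p\<in>P. 2 * ln p / real p ^ j)"
proof -
  let ?f = "\<lambda>(p, k). p ^ k :: nat"
  have "(\<Sum>n\<in>A. mangoldt n / n) = (\<Sum>n | n \<in> A \<and> mangoldt n \<noteq> (0::real). mangoldt n / n)"
    using A(1) by (intro sum.mono_neutral_right) auto
  also have "\<dots> \<le> (\<Sum>n\<in>?f ` (P \<times> {j..X}). mangoldt n / n)"
    using A P by (intro sum_mono2) (force intro!: divide_nonneg_nonneg mangoldt_nonneg)+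
  also have "\<dots> \<le> (\<Sum>x\<in>P \<times> {j..X}. mangoldt (?f x) / real (?f x))"
    using P by (intro order.trans[OF sum_image_le]) (auto intro!: divide_nonneg_nonneg mangoldt_nonneg)
  also have "\<dots> = (\<Sum>p\<in>P. \<Sum>k=j..X. ln p * (1 / p) ^ k)"
    unfolding sum.cartesian_product using P j
    by (intro sum.cong refl) (auto simp: mangoldt_primepow power_divide)
  also have "\<dots> \<le> (\<Sum>p\<in>P. 2 * ln p / real p ^ j)"
  proof (intro sum_mono)
    fix p assume "p \<in> P"
    hence p: "p \<ge> 2" using P(2) prime_ge_2_nat by blast
    have "(\<Sum>k=j..X. ln p * (1 / p) ^ k) = ln p * (\<Sum>k=j..X. (1 / p) ^ k)" by (simp add: sum_distrib_left)
    also have "\<dots> \<le> ln p * (2 * (1 / p) ^ j)"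
      using p by (intro mult_left_mono sum_geometric_tail_le) (auto simp: field_simps)
    finally show "(\<Sum>k=j..X. ln p * (1 / p) ^ k) \<le> 2 * ln p / real p ^ j"
      by (simp add: power_divide mult.commute)
  qed
  finally show ?thesis .
qed

text \<open>An antiderivative of \<open>ln x / x ^ 2\<close> is \<open>- (ln x + 1) / x\<close>. The
  constant 2 in place of 1 leaves room for the discrete induction step and makes the case
  \<open>X = 1\<close> an equality.\<close>

lemma sum_ln_over_square_le:
  assumes "X > 0"
  shows "(\<Sum>n=1..X. ln (real n) / real n ^ 2) \<le> 2 - (ln X + 2) / X"
  using assms
proof (induction X rule: nat_induct_non_zero)
  case (Suc n)
  let ?m = "real (Suc n)"
  have "ln (real n) - ln ?m \<ge> - (1 / n)"
    using ln_Suc_diff_le[of n] Suc by simp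
  hence "?m * (ln (real n) - ln ?m) \<ge> ?m * - (1 / n)" by (intro mult_left_mono) auto
  hence 1: "?m * (ln (real n) - ln ?m) \<ge> - 1 - 1 / n" using Suc by (simp add: field_simps)
  have 2: "1 / n \<le> 1" using Suc by simp
  have "ln ?m / ?m ^ 2 \<le> ln ?m / (n * ?m)"
    using Suc by (intro divide_left_mono) (auto simp: power2_eq_square)
  also have "\<dots> \<le> (?m * (ln (real n) - ln ?m) + ln ?m + 2) / (n * ?m)"
  proof (intro divide_right_mono)
    show "ln ?m \<le> ?m * (ln (real n) - ln ?m) + ln ?m + 2" using 1 2 by linarith
  qed auto
  also have "\<dots> = (ln n + 2) / n - (ln ?m + 2) / ?m"
    using Suc by (simp add: divide_simps del: of_nat_Suc) (simp add: algebra_simps)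
  finally show ?case using Suc by simp
qed simp

lemma sum_mangoldt_nonprime_le:
  "(\<Sum>n | n \<in> {1..X} \<and> \<not> prime n. mangoldt n / n) \<le> 4"
proof (cases "X > 0")
  case True
  have "(\<Sum>n | n \<in> {1..X} \<and> \<not> prime n. mangoldt n / n) \<le> (\<Sum>p | p \<in> {1..X} \<and> prime p. 2 * ln p / real p ^ 2)"
  proof (rule sum_mangoldt_prime_powers_le)
    fix n assume n: "n \<in> {n. n \<in> {1..X} \<and> \<not> prime n}" "mangoldt n \<noteq> (0::real)"
    then obtain p k where pk: "prime p" "k > 0" "n = p ^ k"
      by (auto simp: mangoldt_def primepow_def split: if_splits)
    have "k \<noteq> 1" using pk n by auto
    moreover have "k < p ^ k" using pk prime_gt_1_nat[of p] by (intro power_gt_expt) auto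
    moreover have "p ^ 1 \<le> p ^ k" using pk by (intro power_increasing) (auto simp: Suc_le_eq prime_gt_0_nat)
    ultimately show "\<exists>p\<in>{p. p \<in> {1..X} \<and> prime p}. \<exists>k\<in>{2..X}. n = p ^ k"
      using pk n by (intro bexI[of _ p] bexI[of _ k]) (auto simp: Suc_le_eq prime_gt_0_nat)
  qed auto
  also have "\<dots> \<le> (\<Sum>p=1..X. 2 * ln p / real p ^ 2)" by (intro sum_mono2) auto
  also have "\<dots> = 2 * (\<Sum>p=1..X. ln p / real p ^ 2)" by (simp add: sum_distrib_left)
  also have "\<dots> \<le> 2 * (2 - (ln X + 2) / X)"
    by (intro mult_left_mono sum_ln_over_square_le True) simp
  also have "\<dots> \<le> 4" using True by simp
  finally show ?thesis .
qed auto

lemma sum_mangoldt_not_coprime_le: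
  assumes "N > 0"
  shows "(\<Sum>n | n \<in> {1..X} \<and> \<not> coprime n N. mangoldt n / n) \<le> (\<Sum>p\<in>prime_factors N. 2 * ln p / real p)"
proof -
  have "(\<Sum>n | n \<in> {1..X} \<and> \<not> coprime n N. mangoldt n / n) \<le> (\<Sum>p\<in>prime_factors N. 2 * ln p / real p ^ 1)"
  proof (rule sum_mangoldt_prime_powers_le)
    fix n assume n: "n \<in> {n. n \<in> {1..X} \<and> \<not> coprime n N}" "mangoldt n \<noteq> (0::real)"
    then obtain p k where pk: "prime p" "k > 0" "n = p ^ k"
      by (auto simp: mangoldt_def primepow_def split: if_splits)
    have "k < p ^ k" using pk prime_gt_1_nat[of p] by (intro power_gt_expt) auto
    moreover have "p dvd N" using n pk by (auto intro: ccontr dest: prime_imp_coprime)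
    ultimately show "\<exists>p\<in>prime_factors N. \<exists>k\<in>{1..X}. n = p ^ k"
      using pk n assms by (intro bexI[of _ p] bexI[of _ k]) (auto simp: prime_factors_dvd)
  qed auto
  thus ?thesis by simp
qed

section \<open>Dirichlet characters\<close>

text \<open>Characters are functions on all natural numbers, vanishing exactly off the units. The
  value 1 at 1 need not be demanded: it follows from multiplicativity and
  \<open>\<chi> 1 \<noteq> 0\<close>.\<close>

definition dirichlet_char :: "nat \<Rightarrow> (nat \<Rightarrow> complex) \<Rightarrow> bool" where
  "dirichlet_char N \<chi> \<longleftrightarrow>
     (\<forall>m n. \<chi> (m * n) = \<chi> m * \<chi> n) \<and>
     (\<forall>m n. [m = n] (mod N) \<longrightarrow> \<chi> m = \<chi> n) \<and>
     (\<forall>n. \<chi> n \<noteq> 0 \<longleftrightarrow> coprime n N)"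

definition principal_char :: "nat \<Rightarrow> nat \<Rightarrow> complex" where
  "principal_char N n = of_bool (coprime n N)"

lemma dirichlet_char_mult: "dirichlet_char N \<chi> \<Longrightarrow> \<chi> (m * n) = \<chi> m * \<chi> n"
  by (auto simp: dirichlet_char_def)

lemma dirichlet_char_cong: "dirichlet_char N \<chi> \<Longrightarrow> [m = n] (mod N) \<Longrightarrow> \<chi> m = \<chi> n"
  by (auto simp: dirichlet_char_def)

lemma dirichlet_char_eq_0_iff: "dirichlet_char N \<chi> \<Longrightarrow> \<chi> n = 0 \<longleftrightarrow> \<not> coprime n N"
  by (auto simp: dirichlet_char_def)

lemma dirichlet_char_1 [simp]: "dirichlet_char N \<chi> \<Longrightarrow> \<chi> (Suc 0) = 1"
  using dirichlet_char_mult[of N \<chi> 1 1] dirichlet_char_eq_0_iff[of N \<chi> 1] by simp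

lemma dirichlet_char_power: "dirichlet_char N \<chi> \<Longrightarrow> \<chi> (n ^ k) = \<chi> n ^ k"
  by (induction k) (auto simp: dirichlet_char_mult)

lemma dirichlet_char_root_of_unity:
  assumes "dirichlet_char N \<chi>" "coprime n N"
  shows   "\<chi> n ^ totient N = 1"
  using dirichlet_char_power[OF assms(1), of n "totient N"]
        dirichlet_char_cong[OF assms(1) euler_theorem[OF assms(2)]] assms(1) by simp

lemma norm_dirichlet_char:
  assumes "N > 0" "dirichlet_char N \<chi>"
  shows   "norm (\<chi> n) = of_bool (coprime n N)"
proof (cases "coprime n N")
  case True
  have "norm (\<chi> n) ^ totient N = 1"
    using dirichlet_char_root_of_unity[OF assms(2) True] by (metis norm_one norm_power)
  moreover have "totient N > 0" using assms by simp
  ultimately have "norm (\<chi> n) = 1"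
    by (metis norm_ge_zero power_eq_1_iff real_norm_def abs_norm_cancel not_gr0)
  with True show ?thesis by simp
next
  case False
  with assms show ?thesis by (simp add: dirichlet_char_eq_0_iff)
qed

lemma norm_dirichlet_char_le_1: "N > 0 \<Longrightarrow> dirichlet_char N \<chi> \<Longrightarrow> norm (\<chi> n) \<le> 1"
  by (simp add: norm_dirichlet_char)

lemma coprime_cong_nat: "[m = n] (mod N) \<Longrightarrow> coprime m N \<longleftrightarrow> coprime n (N::nat)"
  using cong_imp_coprime cong_sym by blast

lemma dirichlet_char_principal: "dirichlet_char N (principal_char N)"
  by (auto simp: dirichlet_char_def principal_char_def coprime_cong_nat)

lemma dirichlet_char_times:
  "dirichlet_char N \<chi> \<Longrightarrow> dirichlet_char N \<psi> \<Longrightarrow> dirichlet_char N (\<lambda>n. \<chi> n * \<psi> n)"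
  unfolding dirichlet_char_def by (smt (verit) mult.left_commute mult.assoc mult_eq_0_iff)

lemma dirichlet_char_cnj: "dirichlet_char N \<chi> \<Longrightarrow> dirichlet_char N (\<lambda>n. cnj (\<chi> n))"
  by (auto simp: dirichlet_char_def)

text \<open>A character is determined by its values on \<open>{..<N}\<close>, and each value is 0 or
  a root of unity of order dividing \<open>totient N\<close>.\<close>

lemma finite_dirichlet_chars:
  assumes "N > 0"
  shows   "finite {\<chi>. dirichlet_char N \<chi>}"
proof (rule inj_on_finite)
  let ?V = "insert 0 {z::complex. z ^ totient N = 1}"
  show "inj_on (\<lambda>\<chi>. restrict \<chi> {..<N}) {\<chi>. dirichlet_char N \<chi>}"
  proof (rule inj_onI, rule ext)
    fix \<chi> \<psi> n assume *: "\<chi> \<in> {\<chi>. dirichlet_char N \<chi>}" "\<psi> \<in> {\<chi>. dirichlet_char N \<chi>}"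
      and eq: "restrict \<chi> {..<N} = restrict \<psi> {..<N}"
    have "\<chi> (n mod N) = \<psi> (n mod N)"
      using fun_cong[OF eq, of "n mod N"] assms by simp
    with * show "\<chi> n = \<psi> n"
      by (metis cong_mod_left cong_refl dirichlet_char_cong mem_Collect_eq)
  qed
  show "(\<lambda>\<chi>. restrict \<chi> {..<N}) ` {\<chi>. dirichlet_char N \<chi>} \<subseteq> {..<N} \<rightarrow>\<^sub>E ?V"
  proof (intro image_subsetI restrict_PiE_iff[THEN iffD2] ballI)
    fix \<chi> n assume "\<chi> \<in> {\<chi>. dirichlet_char N \<chi>}"
    thus "\<chi> n \<in> ?V"
      using dirichlet_char_root_of_unity dirichlet_char_eq_0_iff by auto
  qed
  have "totient N > 0" using assms by simp
  hence "finite {z::complex. z ^ totient N = 1}" using finite_roots_unity[of "totient N"] by (simp add: Suc_le_eq)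
  thus "finite ({..<N} \<rightarrow>\<^sub>E ?V)" by (intro finite_PiE) auto
qed

section \<open>Characters on subgroups of the unit group and their extension\<close>

text \<open>
  \<open>H\<close> stands for a subgroup of the unit group modulo \<open>N\<close>, given by the set of all representatives
  of its elements; \<open>\<chi>\<close> is arbitrary outside \<open>H\<close>.
\<close>

definition partial_char :: "nat \<Rightarrow> nat set \<Rightarrow> (nat \<Rightarrow> complex) \<Rightarrow> bool" where
  "partial_char N H \<chi> \<longleftrightarrow>
     (\<forall>n\<in>H. coprime n N) \<and> (\<forall>n\<in>H. \<forall>m. [m = n] (mod N) \<longrightarrow> m \<in> H) \<and>
     (\<forall>n. [n = 1] (mod N) \<longrightarrow> n \<in> H \<and> \<chi> n = 1) \<and>
     (\<forall>m\<in>H. \<forall>n\<in>H. m * n \<in> H \<and> \<chi> (m * n) = \<chi> m * \<chi> n)"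

lemma partial_char_power:
  assumes "partial_char N H \<chi>" "n \<in> H"
  shows   "n ^ k \<in> H \<and> \<chi> (n ^ k) = \<chi> n ^ k"
  using assms by (induction k) (auto simp: partial_char_def)

lemma partial_char_mult:
  assumes "partial_char N H \<chi>" "m \<in> H" "n \<in> H"
  shows   "m * n \<in> H" "\<chi> (m * n) = \<chi> m * \<chi> n"
  using assms by (auto simp: partial_char_def)

lemma partial_char_cong_1:
  assumes "partial_char N H \<chi>" "[n = 1] (mod N)"
  shows   "n \<in> H" "\<chi> n = 1"
  using assms by (auto simp: partial_char_def)

lemma partial_char_inverse:
  assumes "N > 0" "partial_char N H \<chi>" "n \<in> H"
  obtains n' where "n' \<in> H" "[n * n' = 1] (mod N)" "\<chi> n * \<chi> n' = 1"
proof -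
  have cop: "coprime n N" using assms by (auto simp: partial_char_def)
  have t: "totient N > 0" using assms by simp
  \<comment> \<open>By Euler's theorem the inverse is itself a power of \<open>n\<close>, so closure
    of \<open>H\<close> under products keeps it inside \<open>H\<close>.\<close>
  have *: "n * n ^ (totient N - 1) = n ^ totient N"
    using t by (metis power_eq_if not_gr0)
  have "[n * n ^ (totient N - 1) = 1] (mod N)" unfolding * by (rule euler_theorem[OF cop])
  moreover have "n ^ (totient N - 1) \<in> H" using partial_char_power[OF assms(2,3)] by blast
  moreover have "\<chi> n * \<chi> (n ^ (totient N - 1)) = 1"
    using partial_char_mult(2)[OF assms(2,3)] partial_char_cong_1(2)[OF assms(2)] calculation by metis
  ultimately show ?thesis using that by blast
qed

text \<open>The definition fixes the value of \<open>\<chi>\<close> only on the class of 1;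
  multiplication by an inverse carries constancy to every class in \<open>H\<close>.\<close>

lemma partial_char_cong:
  assumes "N > 0" "partial_char N H \<chi>" "n \<in> H" "[m = n] (mod N)"
  shows   "m \<in> H" "\<chi> m = \<chi> n"
proof -
  obtain n' where n': "n' \<in> H" "[n * n' = 1] (mod N)" "\<chi> n * \<chi> n' = 1"
    using partial_char_inverse[OF assms(1-3)] .
  show m: "m \<in> H" using assms by (auto simp: partial_char_def)
  have "[m * n' = 1] (mod N)" using n'(2) assms(4) by (metis cong_scalar_right cong_trans)
  hence "\<chi> m * \<chi> n' = 1"
    using partial_char_mult(2)[OF assms(2) m n'(1)] partial_char_cong_1(2)[OF assms(2)] by simp
  with n'(3) show "\<chi> m = \<chi> n" by (metis mult.assoc mult.commute mult.right_neutral)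
qed

lemma partial_char_cancel:
  assumes "N > 0" "partial_char N H \<chi>" "h \<in> H" "coprime m N" "h * m \<in> H"
  shows   "m \<in> H"
proof -
  obtain h' where h': "h' \<in> H" "[h * h' = 1] (mod N)"
    using partial_char_inverse[OF assms(1-3)] .
  have "[h' * (h * m) = 1 * m] (mod N)"
    using cong_scalar_right[OF h'(2), of m] by (simp add: mult_ac)
  hence "[m = h' * (h * m)] (mod N)" by (simp add: cong_sym)
  thus ?thesis using partial_char_cong(1)[OF assms(1,2)] partial_char_mult(1)[OF assms(2) h'(1) assms(5)] by blast
qed

text \<open>Adjoining \<open>a\<close> to \<open>H\<close>: the only relation between them comes
  from the least positive power \<open>a ^ m\<close> in \<open>H\<close>, so any \<open>w\<close>
  with \<open>w ^ m = \<chi> (a ^ m)\<close> may serve as the value at \<open>a\<close>. An element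
  \<open>n\<close> belongs to the larger group if some \<open>n * a ^ k\<close> lies in
  \<open>H\<close>; since \<open>a\<close> has finite order modulo \<open>N\<close>, non-negative
  \<open>k\<close> suffice.\<close>

lemma partial_char_extend:
  assumes N: "N > 0" and \<chi>: "partial_char N H \<chi>" and a: "coprime a N"
    and m: "m > 0" "a ^ m \<in> H" "\<And>k. 0 < k \<Longrightarrow> a ^ k \<in> H \<Longrightarrow> m \<le> k"
    and w: "w ^ m = \<chi> (a ^ m)"
  obtains H' \<chi>' where "partial_char N H' \<chi>'" "H \<subseteq> H'" "a \<in> H'"
    "\<And>n. n \<in> H \<Longrightarrow> \<chi>' n = \<chi> n" "\<chi>' a = w"
proof -
  have nz: "\<chi> n \<noteq> 0" if "n \<in> H" for n
    using partial_char_inverse[OF N \<chi> that] by (metis mult_zero_left zero_neq_one)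
  have w0: "w \<noteq> 0" using nz[OF m(2)] m(1) w by (auto simp: zero_power)
  have cop: "coprime (a ^ k) N" for k using a by simp
  have dvd: "m dvd k" if "a ^ k \<in> H" for k
  proof -
    have "a ^ k = (a ^ m) ^ (k div m) * a ^ (k mod m)"
      by (metis mult_div_mod_eq power_add power_mult)
    hence "a ^ (k mod m) \<in> H"
      using partial_char_cancel[OF N \<chi> _ cop] partial_char_power[OF \<chi> m(2)] that by metis
    hence "k mod m = 0" using m(3)[of "k mod m"] m(1) by (meson mod_less_divisor not_gr0 not_less)
    thus ?thesis by auto
  qed
  have pw: "\<chi> (a ^ k) = w ^ k" if "a ^ k \<in> H" for k
  proof -
    have "m dvd k" by (rule dvd[OF that])
    then obtain j where "k = m * j" by auto
    thus ?thesis using partial_char_power[OF \<chi> m(2), of j] by (simp add: power_mult w)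
  qed
  have wd': "\<chi> (n * a ^ l) * w ^ k = \<chi> (n * a ^ k) * w ^ l"
    if "n * a ^ k \<in> H" "n * a ^ l \<in> H" "k \<le> l" for n k l
  proof -
    have eq: "n * a ^ l = (n * a ^ k) * a ^ (l - k)"
      using that(3) by (simp add: mult.assoc flip: power_add)
    hence al: "a ^ (l - k) \<in> H"
      using partial_char_cancel[OF N \<chi> that(1) cop] that(2) by metis
    have "w ^ l = w ^ (l - k) * w ^ k" using that(3) by (simp flip: power_add)
    thus ?thesis
      unfolding eq partial_char_mult(2)[OF \<chi> that(1) al] pw[OF al] by simp
  qed
  \<comment> \<open>The quotient does not depend on the exponent, so the choice made by
    \<open>SOME\<close> below is immaterial on \<open>H'\<close>.\<close>
  have wd: "\<chi> (n * a ^ l) / w ^ l = \<chi> (n * a ^ k) / w ^ k"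
    if "n * a ^ k \<in> H" "n * a ^ l \<in> H" for n k l
    using wd'[of n k l] wd'[of n l k] that w0 by (cases "k \<le> l") (auto simp: field_simps)
  define H' where "H' = {n. coprime n N \<and> (\<exists>k. n * a ^ k \<in> H)}"
  define \<chi>' where "\<chi>' n = (let k = (SOME k. n * a ^ k \<in> H) in \<chi> (n * a ^ k) / w ^ k)" for n
  have \<chi>': "\<chi>' n = \<chi> (n * a ^ k) / w ^ k" if "n * a ^ k \<in> H" for n k
    unfolding \<chi>'_def Let_def by (rule wd[OF that]) (rule someI[of "\<lambda>k. n * a ^ k \<in> H", OF that])
  have sub: "n \<in> H' \<and> \<chi>' n = \<chi> n" if "n \<in> H" for n
    using \<chi>'[of n 0] that \<chi> by (auto simp: H'_def partial_char_def intro!: exI[of _ 0])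
  show ?thesis
  proof (rule that[of H' \<chi>'])
    have "n \<in> H'" if "n' \<in> H'" "[n = n'] (mod N)" for n n'
      using that partial_char_cong(1)[OF N \<chi>] cong_scalar_right coprime_cong_nat
      by (fastforce simp: H'_def)
    moreover have "x * y \<in> H' \<and> \<chi>' (x * y) = \<chi>' x * \<chi>' y" if "x \<in> H'" "y \<in> H'" for x y
    proof -
      obtain k l where kl: "x * a ^ k \<in> H" "y * a ^ l \<in> H" using \<open>x \<in> H'\<close> \<open>y \<in> H'\<close> by (auto simp: H'_def)
      have eq: "x * y * a ^ (k + l) = (x * a ^ k) * (y * a ^ l)" by (simp add: power_add)
      have in': "x * y * a ^ (k + l) \<in> H" unfolding eq by (rule partial_char_mult[OF \<chi> kl])
      moreover have "coprime (x * y) N" using that by (auto simp: H'_def)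
      ultimately show ?thesis
        unfolding \<chi>'[OF in'] \<chi>'[OF kl(1)] \<chi>'[OF kl(2)] eq partial_char_mult(2)[OF \<chi> kl]
        using in' by (auto simp: H'_def power_add[of w])
    qed
    moreover have "n \<in> H' \<and> \<chi>' n = 1" if "[n = 1] (mod N)" for n
      using sub[of n] that \<chi> by (auto simp: partial_char_def)
    moreover have "coprime n N" if "n \<in> H'" for n using that by (simp add: H'_def)
    ultimately show "partial_char N H' \<chi>'" unfolding partial_char_def by blast
    \<comment> \<open>The exponent \<open>m - 1\<close> moves \<open>a\<close> into
      \<open>H\<close>, and there the quotient is \<open>w ^ m / w ^ (m - 1) = w\<close>.\<close>
    obtain j where j: "m = Suc j" using m(1) by (cases m) auto
    have "a * a ^ j \<in> H" using m(2) by (simp add: j)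
    moreover have "\<chi> (a * a ^ j) = w * w ^ j" using w by (simp add: j)
    hence "\<chi>' a = w" using \<chi>'[OF calculation] w0 by simp
    ultimately show "a \<in> H'" "\<chi>' a = w" using a by (auto simp: H'_def)
  qed (use sub in auto)
qed

lemma partial_char_extend':
  assumes N: "N > 0" and \<chi>: "partial_char N H \<chi>" and a: "coprime a N"
  obtains H' \<chi>' where "partial_char N H' \<chi>'" "H \<subseteq> H'" "a \<in> H'"
    "\<And>n. n \<in> H \<Longrightarrow> \<chi>' n = \<chi> n"
proof -
  define m where "m = (LEAST m. m > 0 \<and> a ^ m \<in> H)"
  have "totient N > 0 \<and> a ^ totient N \<in> H"
    using N euler_theorem[OF a] \<chi> by (auto simp: partial_char_def)
  hence m: "m > 0 \<and> a ^ m \<in> H" unfolding m_def by (rule LeastI)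
  have least: "m \<le> k" if "0 < k" "a ^ k \<in> H" for k
    unfolding m_def using that by (intro Least_le) auto
  have "\<chi> (a ^ m) \<noteq> 0"
    using partial_char_inverse[OF N \<chi>, of "a ^ m"] m by (metis mult_zero_left zero_neq_one)
  hence "card {z. z ^ m = \<chi> (a ^ m)} = m"
    using m by (intro card_nth_roots) auto
  hence "{z. z ^ m = \<chi> (a ^ m)} \<noteq> {}" using m by (metis card.empty less_irrefl)
  then obtain w where w: "w ^ m = \<chi> (a ^ m)" by auto
  show ?thesis
    by (rule partial_char_extend[OF N \<chi> a _ _ least w]) (use m that in auto)
qed

lemma partial_char_extend_full:
  assumes N: "N > 0" and \<chi>: "partial_char N H \<chi>" and A: "finite A" "\<And>a. a \<in> A \<Longrightarrow> coprime a N"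
  shows "\<exists>H' \<chi>'. partial_char N H' \<chi>' \<and> H \<subseteq> H' \<and> A \<subseteq> H' \<and> (\<forall>n\<in>H. \<chi>' n = \<chi> n)"
  using A
proof (induction A rule: finite_induct)
  case empty
  with \<chi> show ?case by blast
next
  case (insert a A)
  then obtain H1 \<chi>1 where 1: "partial_char N H1 \<chi>1" "H \<subseteq> H1" "A \<subseteq> H1" "\<forall>n\<in>H. \<chi>1 n = \<chi> n"
    by auto
  have "coprime a N" using insert.prems by auto
  then obtain H2 \<chi>2 where
    "partial_char N H2 \<chi>2" "H1 \<subseteq> H2" "a \<in> H2" "\<And>n. n \<in> H1 \<Longrightarrow> \<chi>2 n = \<chi>1 n"
    using partial_char_extend'[OF N 1(1)] by metis
  with 1 show ?case by (intro exI[of _ H2] exI[of _ \<chi>2]) auto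
qed

text \<open>Start from the trivial character on the class of 1. There the least exponent
  \<open>m\<close> is the order of \<open>a\<close>, which exceeds 1, so a root of unity
  \<open>w \<noteq> 1\<close> is available as the value at \<open>a\<close>; the result then extends
  to all units.\<close>

lemma dirichlet_char_separating:
  assumes N: "N > 0" and a: "coprime a N" "\<not> [a = 1] (mod N)"
  obtains \<chi> where "dirichlet_char N \<chi>" "\<chi> a \<noteq> 1"
proof -
  let ?H0 = "{n. [n = 1] (mod N)}"
  have p0: "partial_char N ?H0 (\<lambda>_. 1)"
    using cong_trans cong_mult[of _ 1 N _ 1] by (auto simp: partial_char_def coprime_cong_nat)
  define m where "m = (LEAST m. m > 0 \<and> a ^ m \<in> ?H0)"
  have "totient N > 0 \<and> a ^ totient N \<in> ?H0"
    using N euler_theorem[OF a(1)] by auto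
  hence m: "m > 0 \<and> a ^ m \<in> ?H0" unfolding m_def by (rule LeastI)
  have least: "m \<le> k" if "0 < k" "a ^ k \<in> ?H0" for k
    unfolding m_def using that by (intro Least_le) auto
  have m1: "m \<noteq> 1" using m a(2) by auto
  obtain w :: complex where w: "w ^ m = 1" "w \<noteq> 1"
  proof -
    have "card {z::complex. z ^ m = 1} = m" using m by (intro card_roots_unity_eq) auto
    moreover have "card {z::complex. z ^ m = 1} \<le> 1" if "{z::complex. z ^ m = 1} \<subseteq> {1}"
      using card_mono[OF _ that] by simp
    ultimately show ?thesis using that m m1 by fastforce
  qed
  obtain H1 \<chi>1 where 1: "partial_char N H1 \<chi>1" "a \<in> H1" "\<chi>1 a = w"
    by (rule partial_char_extend[OF N p0 a(1) _ _ least, of w]) (use m w in auto)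
  have "\<exists>H' \<chi>'. partial_char N H' \<chi>' \<and> H1 \<subseteq> H' \<and> {n. n < N \<and> coprime n N} \<subseteq> H' \<and> (\<forall>n\<in>H1. \<chi>' n = \<chi>1 n)"
    by (rule partial_char_extend_full[OF N 1(1)]) simp_all
  then obtain H2 \<chi>2 where 2: "partial_char N H2 \<chi>2" "H1 \<subseteq> H2" "{n. n < N \<and> coprime n N} \<subseteq> H2"
      "\<forall>n\<in>H1. \<chi>2 n = \<chi>1 n"
    by (elim exE conjE)
  have H2: "n \<in> H2 \<longleftrightarrow> coprime n N" for n
  proof
    assume "coprime n N"
    hence "n mod N \<in> H2" using 2(3) N by (auto simp: coprime_commute coprime_mod_right_iff)
    thus "n \<in> H2" using partial_char_cong(1)[OF N 2(1), of "n mod N" n] by simp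
  qed (use 2(1) in \<open>auto simp: partial_char_def\<close>)
  define \<chi> where "\<chi> n = (if coprime n N then \<chi>2 n else 0)" for n
  have "dirichlet_char N \<chi>"
    unfolding dirichlet_char_def
  proof safe
    fix m n :: nat
    show "\<chi> (m * n) = \<chi> m * \<chi> n"
      using partial_char_mult(2)[OF 2(1)] by (auto simp: \<chi>_def H2)
    show "\<chi> m = \<chi> n" if "[m = n] (mod N)"
      using partial_char_cong(2)[OF N 2(1) _ that] coprime_cong_nat[OF that] by (auto simp: \<chi>_def H2)
  next
    fix n assume "coprime n N" "\<chi> n = 0"
    thus False using partial_char_inverse[OF N 2(1), of n] H2[of n]
      by (metis \<chi>_def mult_zero_left zero_neq_one)
  qed (auto simp: \<chi>_def split: if_splits)
  moreover have "\<chi> a \<noteq> 1" using a(1) 1 2 w by (auto simp: \<chi>_def)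
  ultimately show ?thesis using that by blast
qed

section \<open>Sums over a period and orthogonality of characters\<close>

lemma sum_dirichlet_char_period:
  assumes N: "N > 0" and \<chi>: "dirichlet_char N \<chi>" "\<chi> \<noteq> principal_char N"
  shows   "(\<Sum>n<N. \<chi> n) = 0"
proof -
  obtain a where a: "coprime a N" "\<chi> a \<noteq> 1"
    using \<chi> by (fastforce simp: principal_char_def dirichlet_char_eq_0_iff)
  have inj: "inj_on (\<lambda>n. a * n mod N) {..<N}"
  proof (rule inj_onI)
    fix x y assume "x \<in> {..<N}" "y \<in> {..<N}" "a * x mod N = a * y mod N"
    hence "[x = y] (mod N)" using a(1) by (metis cong_def cong_mult_lcancel_nat)
    thus "x = y" using \<open>x \<in> {..<N}\<close> \<open>y \<in> {..<N}\<close> by (simp add: cong_def)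
  qed
  \<comment> \<open>Multiplication by \<open>a\<close> permutes the residues, hence scales the sum
    by \<open>\<chi> a \<noteq> 1\<close> without changing it.\<close>
  have "(\<lambda>n. a * n mod N) ` {..<N} = {..<N}"
    by (rule endo_inj_surj[OF _ _ inj]) (use N in auto)
  hence "(\<Sum>n<N. \<chi> n) = (\<Sum>n<N. \<chi> (a * n mod N))"
    using sum.reindex[OF inj, of \<chi>] by simp
  also have "\<dots> = (\<Sum>n<N. \<chi> a * \<chi> n)"
    using dirichlet_char_cong[OF \<chi>(1), of "a * n mod N" "a * n" for n] dirichlet_char_mult[OF \<chi>(1)]
    by simp
  finally show ?thesis using a(2) by (simp flip: sum_distrib_left)
qed

lemma norm_sum_dirichlet_char_le:
  assumes N: "N > 0" and \<chi>: "dirichlet_char N \<chi>" "\<chi> \<noteq> principal_char N"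
  shows   "norm (\<Sum>n<k. \<chi> n) \<le> N"
proof (induction k rule: less_induct)
  case (less k)
  show ?case
  proof (cases "k \<le> N")
    case True
    have "norm (\<Sum>n<k. \<chi> n) \<le> (\<Sum>n<k. 1)"
      using norm_dirichlet_char_le_1[OF N \<chi>(1)] by (intro sum_norm_le)
    with True show ?thesis by simp
  next
    case False
    have "(\<Sum>n<k. \<chi> n) = (\<Sum>n<N. \<chi> n) + (\<Sum>n\<in>{N..<k}. \<chi> n)"
      using False by (simp add: ivl_disj_un(17)[symmetric] atLeast0LessThan[symmetric] sum.atLeastLessThan_concat)
    also have "(\<Sum>n\<in>{N..<k}. \<chi> n) = (\<Sum>n<k - N. \<chi> (n + N))"
      using False sum.shift_bounds_nat_ivl[of \<chi> 0 N "k - N"] by (simp add: atLeast0LessThan)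
    also have "\<dots> = (\<Sum>n<k - N. \<chi> n)"
      using dirichlet_char_cong[OF \<chi>(1), of "n + N" n for n] by (simp add: cong_def)
    finally show ?thesis
      using less.IH[of "k - N"] False N sum_dirichlet_char_period[OF assms] by simp
  qed
qed

text \<open>If \<open>a\<close> is a unit other than 1, multiplication by a character
  \<open>\<psi>\<close> with \<open>\<psi> a \<noteq> 1\<close> permutes the characters and
  multiplies the sum by \<open>\<psi> a\<close>.\<close>

lemma sum_over_dirichlet_chars:
  assumes N: "N > 0"
  shows "(\<Sum>\<chi> | dirichlet_char N \<chi>. \<chi> a) = (if [a = 1] (mod N) then card {\<chi>. dirichlet_char N \<chi>} else 0)"
proof (cases "[a = 1] (mod N)")
  case True
  have "\<chi> a = 1" if "dirichlet_char N \<chi>" for \<chi>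
    using dirichlet_char_cong[OF that True] that by simp
  hence "(\<Sum>\<chi> | dirichlet_char N \<chi>. \<chi> a) = (\<Sum>\<chi> | dirichlet_char N \<chi>. 1)"
    by (intro sum.cong) auto
  with True show ?thesis by simp
next
  case False
  show ?thesis
  proof (cases "coprime a N")
    case True
    obtain \<psi> where \<psi>: "dirichlet_char N \<psi>" "\<psi> a \<noteq> 1"
      using dirichlet_char_separating[OF N True False] .
    let ?D = "{\<chi>. dirichlet_char N \<chi>}"
    have inj: "inj_on (\<lambda>\<chi> n. \<psi> n * \<chi> n) ?D"
    proof (rule inj_onI, rule ext)
      fix \<chi> \<chi>' n assume *: "\<chi> \<in> ?D" "\<chi>' \<in> ?D" "(\<lambda>n. \<psi> n * \<chi> n) = (\<lambda>n. \<psi> n * \<chi>' n)"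
      show "\<chi> n = \<chi>' n"
        using * fun_cong[OF *(3), of n] dirichlet_char_eq_0_iff[OF \<psi>(1), of n]
          dirichlet_char_eq_0_iff[of N \<chi> n] dirichlet_char_eq_0_iff[of N \<chi>' n]
        by (cases "coprime n N") auto
    qed
    have "(\<lambda>\<chi> n. \<psi> n * \<chi> n) ` ?D = ?D"
      using \<psi> by (intro endo_inj_surj[OF finite_dirichlet_chars[OF N] _ inj])
                 (auto intro: dirichlet_char_times)
    hence "(\<Sum>\<chi>\<in>?D. \<chi> a) = (\<Sum>\<chi>\<in>?D. \<psi> a * \<chi> a)"
      using sum.reindex[OF inj, of "\<lambda>\<chi>. \<chi> a"] by (simp add: o_def)
    with \<psi>(2) False show ?thesis by (simp flip: sum_distrib_left)
  qed (use False in \<open>auto simp: dirichlet_char_eq_0_iff intro!: sum.neutral\<close>)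
qed

text \<open>On units conjugation is inversion, so with \<open>b\<close> inverse to \<open>a\<close>
  modulo \<open>N\<close> this is the sum of all characters at \<open>n * b\<close>.\<close>

lemma dirichlet_char_orthogonality:
  assumes N: "N > 0" and a: "coprime a N"
  shows "(\<Sum>\<chi> | dirichlet_char N \<chi>. cnj (\<chi> a) * \<chi> n) =
           (if [n = a] (mod N) then card {\<chi>. dirichlet_char N \<chi>} else 0)"
proof -
  obtain b where b: "[a * b = 1] (mod N)" using cong_solve_coprime_nat[OF a] by auto
  have "cnj (\<chi> a) * \<chi> n = \<chi> (n * b)" if \<chi>: "dirichlet_char N \<chi>" for \<chi>
  proof -
    have "\<chi> a * \<chi> b = 1"
      using dirichlet_char_cong[OF \<chi> b] dirichlet_char_mult[OF \<chi>] \<chi> by simp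
    moreover have "\<chi> a * cnj (\<chi> a) = 1"
      using norm_dirichlet_char[OF N \<chi>, of a] a by (simp flip: complex_norm_square)
    ultimately have "cnj (\<chi> a) = \<chi> b" by (metis mult_left_cancel mult_zero_left zero_neq_one)
    thus ?thesis using dirichlet_char_mult[OF \<chi>] by simp
  qed
  moreover have "[n * b = 1] (mod N) \<longleftrightarrow> [n = a] (mod N)"
  proof
    assume "[n * b = 1] (mod N)"
    hence "[a * (n * b) = a * 1] (mod N)" by (intro cong_mult cong_refl)
    moreover have "[a * b * n = 1 * n] (mod N)" using b by (rule cong_scalar_right)
    ultimately show "[n = a] (mod N)" by (simp add: mult_ac) (meson cong_sym cong_trans)
  next
    assume "[n = a] (mod N)"
    thus "[n * b = 1] (mod N)" using b by (meson cong_scalar_right cong_trans)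
  qed
  ultimately show ?thesis using sum_over_dirichlet_chars[OF N, of "n * b"] by simp
qed

section \<open>The value of the L-series at 1\<close>

lemma ln_over_antimono:
  assumes "n \<ge> 3"
  shows   "ln (real (Suc n)) / real (Suc n) \<le> ln (real n) / real n"
proof -
  have "exp 1 \<le> real n" using exp_le assms by linarith
  hence 1: "1 \<le> ln (real n)" using assms by (simp add: ln_ge_iff)
  have "real n * (ln (real (Suc n)) - ln n) \<le> 1"
    using ln_Suc_diff_le[of n] assms by (simp add: field_simps)
  hence "real n * ln (real (Suc n)) \<le> real (Suc n) * ln n"
    using 1 by (simp add: algebra_simps)
  thus ?thesis using assms by (simp add: field_simps)
qed

locale nonprincipal_char =
  fixes N :: nat and \<chi> :: "nat \<Rightarrow> complex"
  assumes N: "N > 0" and dirichlet: "dirichlet_char N \<chi>" and nonprincipal: "\<chi> \<noteq> principal_char N"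
begin

lemmas char_mult = dirichlet_char_mult[OF dirichlet]
lemmas norm_char_le = norm_dirichlet_char_le_1[OF N dirichlet]
lemmas norm_sum_char_le = norm_sum_dirichlet_char_le[OF N dirichlet nonprincipal]

definition partial_L where "partial_L y = (\<Sum>m=1..y. \<chi> m / m)"

definition L_value where "L_value = lim partial_L"

definition mangoldt_sum where "mangoldt_sum X = (\<Sum>n=1..X. \<chi> n * mangoldt n / n)"

lemma norm_partial_L_diff:
  assumes "y \<le> z"
  shows   "norm (partial_L z - partial_L y) \<le> 2 * N / real (y + 1)"
proof -
  have "partial_L z - partial_L y = (\<Sum>n\<in>{y+1..<z+1}. \<chi> n * of_real (1 / real n))"
    using assms unfolding partial_L_def
    by (induction z rule: dec_induct) auto
  also have "norm \<dots> \<le> 2 * real N * (1 / real (y + 1))"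
    by (rule norm_sum_mult_antimono_le[OF norm_sum_char_le]) (auto simp: field_simps)
  finally show ?thesis by simp
qed

lemma partial_L_tendsto: "partial_L \<longlonglongrightarrow> L_value"
proof -
  have "Cauchy partial_L"
  proof (rule CauchyI)
    fix e :: real assume e: "e > 0"
    obtain M where M: "real M > 2 * N / e" using reals_Archimedean2 by blast
    have *: "norm (partial_L n - partial_L m) < e" if "m \<ge> M" "m \<le> n" for m n
    proof -
      have "norm (partial_L n - partial_L m) \<le> 2 * N / real (m + 1)"
        by (rule norm_partial_L_diff[OF that(2)])
      also have "\<dots> < e" using M that(1) e N by (simp add: field_simps) (smt (verit) mult_left_mono of_nat_mono)
      finally show ?thesis .
    qed
    show "\<exists>M. \<forall>m\<ge>M. \<forall>n\<ge>M. norm (partial_L m - partial_L n) < e"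
      using * by (metis nle_le norm_minus_commute)
  qed
  thus ?thesis unfolding L_value_def by (simp add: Cauchy_convergent_iff convergent_LIMSEQ_iff)
qed

lemma norm_partial_L_minus_L: "norm (partial_L y - L_value) \<le> 2 * N / real (y + 1)"
proof (rule LIMSEQ_le_const2)
  show "(\<lambda>z. norm (partial_L y - partial_L z)) \<longlonglongrightarrow> norm (partial_L y - L_value)"
    by (intro tendsto_intros partial_L_tendsto)
  show "\<exists>M. \<forall>z\<ge>M. norm (partial_L y - partial_L z) \<le> 2 * N / real (y + 1)"
    using norm_partial_L_diff by (metis norm_minus_commute)
qed

text \<open>Stated with the factor \<open>d / X\<close> because in the applications below the
  \<open>d\<close> cancels against a weight \<open>1 / d\<close>.\<close>

lemma norm_partial_L_div_minus_L:
  assumes "d > 0" "X > 0"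
  shows   "norm (partial_L (X div d) - L_value) \<le> 2 * N * (d / X)"
proof -
  have "norm (partial_L (X div d) - L_value) \<le> 2 * N / real (X div d + 1)"
    by (rule norm_partial_L_minus_L)
  also have "\<dots> \<le> 2 * N / (real X / real d)"
    using real_div_le_Suc[of X d] assms by (intro divide_left_mono) auto
  finally show ?thesis by simp
qed

lemma ln_sum_bounded: "\<exists>C. \<forall>X. norm (\<Sum>n=1..X. \<chi> n * ln (real n) / n) \<le> C"
proof -
  let ?f = "\<lambda>n. \<chi> n * of_real (ln (real n) / real n)"
  have "norm (\<Sum>n=1..X. \<chi> n * ln (real n) / n) \<le> norm (?f 1) + norm (?f 2) + 2 * N * (ln 3 / 3)" for X
  proof -
    have tail: "norm (\<Sum>n\<in>{3..<Suc X}. ?f n) \<le> 2 * real N * (ln (real 3) / real 3)"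
      by (rule norm_sum_mult_antimono_le) (use norm_sum_char_le ln_over_antimono in auto)
    consider "X = 0" | "X = 1" | "X \<ge> 2" by linarith
    thus ?thesis
    proof cases
      assume "X \<ge> 2"
      \<comment> \<open>The first two terms are split off because \<open>ln n / n\<close> decreases
        only from \<open>n = 3\<close> on.\<close>
      hence "{1..X} = insert 1 (insert 2 {3..<Suc X})" by auto
      hence "(\<Sum>n=1..X. ?f n) = ?f 1 + ?f 2 + (\<Sum>n\<in>{3..<Suc X}. ?f n)" by simp
      hence "norm (\<Sum>n=1..X. ?f n) \<le> norm (?f 1) + norm (?f 2) + norm (\<Sum>n\<in>{3..<Suc X}. ?f n)"
        by (simp only: norm_triangle_le norm_triangle_ineq add_right_mono)
      with tail show ?thesis by simp
    qed auto
  qed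
  thus ?thesis by blast
qed

text \<open>Expanding \<open>ln n\<close> as a divisor sum of \<open>mangoldt\<close> rewrites the
  bounded logarithmic sum with inner factors \<open>partial_L (X div d)\<close>. Replacing each of
  these by \<open>L_value\<close> costs at most
  \<open>(2 * N / X) * (\<Sum>d=1..X. mangoldt d)\<close>, which Chebyshev's bound limits to
  \<open>8 * N\<close>.\<close>

lemma L_mult_mangoldt_sum_bounded: "\<exists>C. \<forall>X>0. norm (L_value * mangoldt_sum X) \<le> C"
proof -
  obtain C where C: "\<And>X. norm (\<Sum>n=1..X. \<chi> n * ln (real n) / n) \<le> C"
    using ln_sum_bounded by blast
  have "norm (L_value * mangoldt_sum X) \<le> C + 8 * N" if X: "X > 0" for X
  proof -
    let ?g = "\<lambda>d. \<chi> d * mangoldt d / d"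
    have "(\<Sum>n=1..X. \<chi> n * ln (real n) / n) =
          (\<Sum>n=1..X. \<Sum>d | d dvd n. ?g d * (\<chi> (n div d) / real (n div d)))"
    proof (intro sum.cong refl)
      fix n assume n: "n \<in> {1..X}"
      have "\<chi> n * ln (real n) / n = (\<Sum>d | d dvd n. \<chi> n / n * mangoldt d)"
        using mangoldt_sum[of n, where ?'a = complex] n
        by (subst sum_distrib_left[symmetric]) simp
      also have "\<dots> = (\<Sum>d | d dvd n. ?g d * (\<chi> (n div d) / real (n div d)))"
      proof (intro sum.cong refl)
        fix d assume "d \<in> {d. d dvd n}"
        then obtain e where e: "n = d * e" by auto
        thus "\<chi> n / n * mangoldt d = ?g d * (\<chi> (n div d) / real (n div d))"
          using n by (simp add: char_mult)
      qed
      finally show "\<chi> n * ln (real n) / n = \<dots>" .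
    qed
    also have "\<dots> = (\<Sum>d=1..X. \<Sum>m=1..X div d. ?g d * (\<chi> m / m))"
      by (subst sum_divisors_swap[where F = "\<lambda>d m. ?g d * (\<chi> m / m)", symmetric]) simp
    also have "\<dots> = (\<Sum>d=1..X. ?g d * partial_L (X div d))"
      by (simp add: partial_L_def sum_distrib_left)
    finally have ln_sum: "(\<Sum>n=1..X. \<chi> n * ln (real n) / n) = (\<Sum>d=1..X. ?g d * partial_L (X div d))" .
    have "(\<Sum>d=1..X. ?g d * (partial_L (X div d) - L_value)) =
            (\<Sum>d=1..X. ?g d * partial_L (X div d)) - (\<Sum>d=1..X. ?g d) * L_value"
      by (simp only: right_diff_distrib sum_subtractf sum_distrib_right)
    hence eq: "L_value * mangoldt_sum X = (\<Sum>n=1..X. \<chi> n * ln (real n) / n) -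
              (\<Sum>d=1..X. ?g d * (partial_L (X div d) - L_value))"
      unfolding ln_sum by (simp add: mangoldt_sum_def mult.commute)
    have "norm (\<Sum>d=1..X. ?g d * (partial_L (X div d) - L_value)) \<le> (\<Sum>d=1..X. mangoldt d * (2 * N / X))"
    proof (intro sum_norm_le)
      fix d assume d: "d \<in> {1..X}"
      have "norm (?g d) \<le> mangoldt d / d"
        using norm_char_le[of d]
        by (auto simp: norm_mult norm_divide mangoldt_nonneg intro!: divide_right_mono mult_left_le_one_le)
      hence "norm (?g d * (partial_L (X div d) - L_value)) \<le> (mangoldt d / d) * (2 * N * (d / X))"
        unfolding norm_mult[of "?g d"] using d X norm_partial_L_div_minus_L[of d X]
        by (intro mult_mono) (auto intro!: divide_nonneg_nonneg simp: mangoldt_nonneg)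
      thus "norm (?g d * (partial_L (X div d) - L_value)) \<le> mangoldt d * (2 * N / X)"
        using d by (simp add: field_simps)
    qed
    also have "\<dots> = (\<Sum>d=1..X. mangoldt d) * (2 * N / X)" by (rule sum_distrib_right[symmetric])
    also have "\<dots> \<le> (4 * real X) * (2 * N / X)" by (intro mult_right_mono sum_mangoldt_le) auto
    also have "\<dots> = 8 * N" using X by simp
    finally show ?thesis unfolding eq
      using C[of X] by (smt (verit) norm_triangle_ineq4)
  qed
  thus ?thesis by blast
qed

text \<open>The Moebius-weighted sum of \<open>ln (X / d)\<close> is evaluated twice. Splitting
  \<open>ln (X / d) = ln (X / n) + ln (n / d)\<close> gives \<open>ln X + mangoldt_sum X\<close>,
  the first part surviving only at \<open>n = 1\<close>. Exchanging the sums instead leaves factors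
  \<open>partial_L (X div d)\<close>, which are small because the limit is 0; the total error is
  controlled by the lower bound for \<open>ln (fact X)\<close>.\<close>

lemma mangoldt_sum_if_L_eq_0:
  assumes "L_value = 0" "X > 0"
  shows   "norm (ln X + mangoldt_sum X) \<le> 2 * N"
proof -
  let ?g = "\<lambda>d. \<chi> d / d * of_real (moebius d * ln (real X / real d))"
  have "(\<Sum>n=1..X. \<chi> n / n * (\<Sum>d | d dvd n. moebius d * ln (real X / real d))) =
        (\<Sum>n=1..X. (if n = 1 then of_real (ln X) else 0) + \<chi> n * mangoldt n / n)"
  proof (intro sum.cong refl)
    fix n assume n: "n \<in> {1..X}"
    have "(\<Sum>d | d dvd n. moebius d * ln (real X / real d)) =
          (\<Sum>d | d dvd n. moebius d * ln (real X / real n) + moebius d * ln (real n / real d))"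
      using n assms(2) by (intro sum.cong refl) (auto simp: ln_div algebra_simps intro!: Nat.gr0I)
    also have "\<dots> = of_bool (n = 1) * ln (real X / real n) + mangoldt n"
      using n by (simp add: sum.distrib sum_moebius_ln sum_moebius flip: sum_distrib_right)
    finally show "\<chi> n / n * (\<Sum>d | d dvd n. moebius d * ln (real X / real d)) =
      (if n = 1 then of_real (ln X) else 0) + \<chi> n * mangoldt n / n"
      using dirichlet by auto
  qed
  also have "\<dots> = ln X + mangoldt_sum X"
    using assms(2) by (simp add: mangoldt_sum_def sum.distrib)
  also have "(\<Sum>n=1..X. \<chi> n / n * (\<Sum>d | d dvd n. moebius d * ln (real X / real d))) =
             (\<Sum>n=1..X. \<Sum>d | d dvd n. ?g d * (\<chi> (n div d) / real (n div d)))"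
    unfolding of_real_sum sum_distrib_left
  proof (intro sum.cong refl)
    fix n d assume n: "n \<in> {1..X}" and "d \<in> {d. d dvd n}"
    then obtain e where e: "n = d * e" by auto
    thus "\<chi> n / n * of_real (moebius d * ln (real X / real d)) = ?g d * (\<chi> (n div d) / real (n div d))"
      using n by (simp add: char_mult)
  qed
  also have "\<dots> = (\<Sum>d=1..X. \<Sum>m=1..X div d. ?g d * (\<chi> m / m))"
    by (subst sum_divisors_swap[where F = "\<lambda>d m. ?g d * (\<chi> m / m)", symmetric]) simp
  also have "\<dots> = (\<Sum>d=1..X. ?g d * (partial_L (X div d) - L_value))"
    by (simp add: partial_L_def sum_distrib_left assms(1))
  finally have "norm (ln X + mangoldt_sum X) = norm \<dots>" by simp
  also have "\<dots> \<le> (\<Sum>d=1..X. ln (real X / real d) * (2 * N / X))"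
  proof (intro sum_norm_le)
    fix d assume d: "d \<in> {1..X}"
    have ln: "ln (real X / real d) \<ge> 0" using d by (intro ln_ge_zero) auto
    have "norm (?g d) \<le> (1 / d) * (1 * ln (real X / real d))"
      unfolding norm_mult norm_divide of_real_mult norm_of_real
      using norm_char_le[of d] abs_moebius_le[of d] ln by (intro mult_mono) (auto simp: divide_right_mono)
    hence "norm (?g d * (partial_L (X div d) - L_value)) \<le> (1 / d) * (1 * ln (real X / real d)) * (2 * N * (d / X))"
      unfolding norm_mult[of "?g d"] using d assms(2) ln norm_partial_L_div_minus_L[of d X]
      by (intro mult_mono) auto
    thus "norm (?g d * (partial_L (X div d) - L_value)) \<le> ln (real X / real d) * (2 * N / X)"
      using d by (simp add: field_simps)
  qed
  also have "\<dots> = (\<Sum>d=1..X. ln X - ln d) * (2 * N / X)"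
    unfolding sum_distrib_right[symmetric] using assms(2) by (simp add: ln_div)
  also have "(\<Sum>d=1..X. ln X - ln d) = X * ln X - ln (fact X)"
  proof -
    have "ln (fact X :: real) = (\<Sum>d=1..X. ln (real d))"
      by (induction X) (auto simp: ln_mult simp del: of_nat_Suc)
    thus ?thesis by (simp add: sum_subtractf)
  qed
  also have "(X * ln X - ln (fact X)) * (2 * N / X) \<le> X * (2 * N / X)"
    using ln_fact_ge[OF assms(2)] by (intro mult_right_mono) auto
  finally show ?thesis using assms(2) by simp
qed

lemma mangoldt_sum_bounded:
  assumes "L_value \<noteq> 0"
  shows   "\<exists>C. \<forall>X>0. norm (mangoldt_sum X) \<le> C"
proof -
  obtain C where C: "\<And>X. X > 0 \<Longrightarrow> norm (L_value * mangoldt_sum X) \<le> C"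
    using L_mult_mangoldt_sum_bounded by blast
  have "norm (mangoldt_sum X) \<le> C / norm L_value" if "X > 0" for X
    using C[OF that] assms by (simp add: norm_mult field_simps)
  thus ?thesis by blast
qed

text \<open>A one-sided bound holds whether or not the L-value vanishes, because the term
  \<open>- ln X\<close> arising when it does is not positive.\<close>

lemma Re_mangoldt_sum_bounded: "\<exists>C. \<forall>X>0. Re (mangoldt_sum X) \<le> C"
proof (cases "L_value = 0")
  case True
  have "Re (mangoldt_sum X) \<le> 2 * N" if "X > 0" for X
  proof -
    have "ln (real X) \<ge> 0" using that by simp
    thus ?thesis
      using mangoldt_sum_if_L_eq_0[OF True that] complex_Re_le_cmod[of "ln X + mangoldt_sum X"] by simp
  qed
  thus ?thesis by blast
next
  case False
  thus ?thesis using mangoldt_sum_bounded complex_Re_le_cmod order.trans by meson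
qed

end

section \<open>Divisor sums of real characters\<close>

lemma sum_divisors_coprime_mult:
  fixes f :: "nat \<Rightarrow> 'a :: comm_semiring_1"
  assumes "coprime a b" "a > 0" "b > 0" and f: "\<And>x y. f (x * y) = f x * f y"
  shows   "(\<Sum>d | d dvd a * b. f d) = (\<Sum>d | d dvd a. f d) * (\<Sum>d | d dvd b. f d)"
proof -
  let ?S = "{d. d dvd a} \<times> {d. d dvd b}"
  have inj: "inj_on (\<lambda>(x, y). x * y) ?S"
  proof (rule inj_onI, clarify)
    fix x y x' y' assume *: "x dvd a" "y dvd b" "x' dvd a" "y' dvd b" "x * y = x' * y'"
    have cop: "coprime u v" if "u dvd a" "v dvd b" for u v
      using that assms(1) coprime_divisors by blast
    have "x dvd x'" using *(5) cop[of x y'] * by (metis coprime_dvd_mult_left_iff dvd_triv_left)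
    moreover have "x' dvd x" using *(5) cop[of x' y] * by (metis coprime_dvd_mult_left_iff dvd_triv_left)
    ultimately have "x = x'" by (rule dvd_antisym)
    moreover have "x > 0" using * assms(2) by (auto intro: dvd_pos_nat)
    ultimately show "x = x' \<and> y = y'" using *(5) by auto
  qed
  have "(\<lambda>(x, y). x * y) ` ?S = {d. d dvd a * b}"
  proof safe
    fix d assume "d dvd a * b"
    then obtain x y where "d = x * y" "x dvd a" "y dvd b" using division_decomp by blast
    thus "d \<in> (\<lambda>(x, y). x * y) ` ?S" by auto
  qed (auto intro: mult_dvd_mono)
  hence "(\<Sum>d | d dvd a * b. f d) = (\<Sum>z\<in>?S. f (case z of (x, y) \<Rightarrow> x * y))"
    using sum.reindex[OF inj, of f] by simp
  also have "\<dots> = (\<Sum>x | x dvd a. \<Sum>y | y dvd b. f x * f y)"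
    unfolding sum.cartesian_product by (intro sum.cong) (auto simp: f)
  finally show ?thesis by (simp add: sum_product)
qed

text \<open>The divisor sum is multiplicative, so one prime power is split off at a time. Its factor
  \<open>1 + r p + \<dots> + r p ^ k\<close> is \<open>k + 1\<close>, \<open>1\<close> or
  \<open>of_bool (even k)\<close> according as \<open>r p\<close> is 1, 0 or -1, hence is
  non-negative always and at least 1 for even \<open>k\<close>. In a square every exponent is
  even.\<close>

lemma sum_divisors_real_char_nonneg:
  fixes r :: "nat \<Rightarrow> real"
  assumes r: "\<And>x y. r (x * y) = r x * r y" "r 1 = 1" "\<And>n. r n \<in> {-1, 0, 1}" and m: "m > 0"
  shows   "(\<Sum>d | d dvd m. r d) \<ge> of_bool (\<exists>k. m = k ^ 2)"
  using m
proof (induction m rule: less_induct)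
  case (less m)
  show ?case
  proof (cases "m = 1")
    case True
    thus ?thesis using r(2) by (auto simp: of_bool_def)
  next
    case False
    then obtain p where p: "prime p" "p dvd m" using prime_factor_nat by blast
    define k where "k = multiplicity p m"
    obtain m' where m': "m = p ^ k * m'" "\<not> p dvd m'"
      unfolding k_def using p less.prems by (metis multiplicity_decompose' not_gr0 not_prime_unit)
    have k: "k > 0" using p m' by (cases k) auto
    have pos: "p ^ k > 0" "m' > 0" using less.prems m' by auto
    have "1 * m' < p ^ k * m'"
      using prime_gt_1_nat[OF p(1)] k pos by (intro mult_strict_right_mono one_less_power) auto
    hence "m' < m" using m' by simp
    note IH = less.IH[OF this pos(2)]
    have cop: "coprime (p ^ k) m'" using p(1) m'(2) by (simp add: prime_imp_coprime)
    have rp: "r (p ^ j) = r p ^ j" for j using r(1,2) by (induction j) auto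
    have "(\<Sum>d | d dvd p ^ k. r d) = (\<Sum>d\<in>(\<lambda>j. p ^ j) ` {..k}. r d)"
      using p(1) by (intro sum.cong) (auto simp: divides_primepow_nat)
    also have "\<dots> = (\<Sum>j\<le>k. r p ^ j)"
      using prime_gt_1_nat[OF p(1)] by (subst sum.reindex) (auto simp: rp inj_on_def)
    finally have eq: "(\<Sum>d | d dvd m. r d) = (\<Sum>j\<le>k. r p ^ j) * (\<Sum>d | d dvd m'. r d)"
      using sum_divisors_coprime_mult[OF cop pos, of r] r(1) by (simp add: m')
    have minus: "(\<Sum>j\<le>n. (-1) ^ j :: real) = of_bool (even n)" for n
      by (induction n) auto
    have zero: "(\<Sum>j\<le>n. 0 ^ j :: real) = 1" for n
      by (induction n) auto
    have pw: "(\<Sum>j\<le>k. r p ^ j) \<ge> of_bool (even k)"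
      using r(3)[of p] by (auto simp: minus zero)
    have sq: "even k \<and> (\<exists>l. m' = l ^ 2)" if square: "\<exists>l. m = l ^ 2"
    proof -
      obtain l where l: "m = l ^ 2" using square by blast
      have "k = 2 * multiplicity p l"
        unfolding k_def l using p(1) less.prems l by (subst prime_elem_multiplicity_power_distrib) auto
      hence ev: "even k" by simp
      then obtain j where j: "k = 2 * j" by auto
      have "l ^ 2 = (p ^ j) ^ 2 * m'" using l m'(1) j by (simp add: power_mult mult.commute)
      hence "(p ^ j) ^ 2 dvd l ^ 2" by simp
      hence "p ^ j dvd l" by (simp only: pow_divides_pow_iff zero_less_numeral)
      then obtain c where "l = p ^ j * c" by auto
      hence "m' = c ^ 2" using \<open>l ^ 2 = (p ^ j) ^ 2 * m'\<close> p(1) by (simp add: power_mult_distrib)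
      with ev show ?thesis by blast
    qed
    have "of_bool (\<exists>l. m = l ^ 2) \<le> of_bool (even k) * (of_bool (\<exists>l. m' = l ^ 2) :: real)"
      using sq by auto
    also have "\<dots> \<le> (\<Sum>j\<le>k. r p ^ j) * (\<Sum>d | d dvd m'. r d)"
      using pw IH by (intro mult_mono order.trans[OF _ pw]) auto
    finally show ?thesis by (simp only: eq)
  qed
qed

section \<open>Monsky's argument for real characters\<close>

lemma geometric_sum_ge:
  fixes u :: real
  assumes "0 < u"
  shows   "real n * u ^ (n - 1) \<le> (\<Sum>i<n. (u ^ 2) ^ i)"
proof -
  have "2 * (real n * u ^ (n - 1)) = (\<Sum>i<n. 2 * u ^ (n - 1))" by simp
  \<comment> \<open>The terms with indices \<open>i\<close> and \<open>n - 1 - i\<close> have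
    geometric mean \<open>u ^ (n - 1)\<close>; the ratio is written as \<open>u ^ 2\<close> to avoid
    half-integral exponents.\<close>
  also have "\<dots> \<le> (\<Sum>i<n. (u ^ 2) ^ i + (u ^ 2) ^ (n - Suc i))"
  proof (intro sum_mono)
    fix i assume "i \<in> {..<n}"
    hence "n - 1 = i + (n - Suc i)" by auto
    hence "u ^ (n - 1) = u ^ i * u ^ (n - Suc i)" by (metis power_add)
    moreover have "0 \<le> (u ^ i - u ^ (n - Suc i)) ^ 2" by simp
    moreover have "(u ^ 2) ^ j = (u ^ j) ^ 2" for j by (simp flip: power_mult add: mult.commute)
    ultimately show "2 * u ^ (n - 1) \<le> (u ^ 2) ^ i + (u ^ 2) ^ (n - Suc i)"
      by (simp add: power2_diff)
  qed
  also have "\<dots> = 2 * (\<Sum>i<n. (u ^ 2) ^ i)"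
    by (simp add: sum.distrib sum.nat_diff_reindex[of "\<lambda>i. (u ^ 2) ^ i"])
  finally show ?thesis by simp
qed

text \<open>
  If \<open>\<Sum>n. \<chi> n / n = 0\<close>, then \<open>\<Sum>n. \<chi> n * monsky t n\<close> is the negative of the Lambert series
  \<open>\<Sum>n. \<chi> n * t ^ n / (1 - t ^ n)\<close>. The former is bounded since \<open>monsky t\<close> decreases from \<open>1\<close>;
  for real \<open>\<chi>\<close>, the latter is unbounded as \<open>t\<close> tends to \<open>1\<close> since its coefficients are non-negative, and at least 1 at squares.
\<close>

definition monsky :: "real \<Rightarrow> nat \<Rightarrow> real" where
  "monsky t n = 1 / (n * (1 - t)) - t ^ n / (1 - t ^ n)"

text \<open>With \<open>s n = 1 + t + \<dots> + t ^ (n - 1)\<close>, the consecutive difference of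
  \<open>(1 - t) * monsky t n\<close> is
  \<open>1 / (n * (n + 1)) - t ^ n / (s n * s (n + 1))\<close>. The means inequality gives
  \<open>s n * s (n + 1) \<ge> n * (n + 1) * u ^ (2 * n - 1)\<close>, and
  \<open>u ^ (2 * n - 1) \<ge> t ^ n\<close>.\<close>

lemma monsky_bounds:
  fixes u :: real
  assumes u: "0 < u" "u < 1" and n: "n > 0"
  shows   "monsky (u ^ 2) (Suc n) \<le> monsky (u ^ 2) n" "0 \<le> monsky (u ^ 2) n"
proof -
  define t where "t = u ^ 2"
  define s where "s n = (\<Sum>i<n. t ^ i)" for n
  have t: "0 < t" "t < 1" using u by (auto simp: t_def power_less_one_iff)
  have s: "s n = (1 - t ^ n) / (1 - t)" for n
    using t by (simp add: s_def sum_gp_strict)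
  have ge: "real n * u ^ (n - 1) \<le> s n" for n
    unfolding s_def t_def using geometric_sum_ge[OF u(1)] .
  have pos: "s n > 0" if "n > 0" for n
    using that u by (intro less_le_trans[OF _ ge]) auto
  have m: "monsky t n = (1 / n - t ^ n / s n) / (1 - t)" for n
    using t unfolding s monsky_def diff_divide_distrib[of "1 / real n"] by simp
  have tn: "t ^ n = u ^ n * u ^ n" for n by (simp add: t_def power2_eq_square power_mult_distrib)
  have "n * t ^ n \<le> n * u ^ (n - 1)"
  proof -
    have "t ^ n \<le> u ^ (n - 1)"
      unfolding tn power_add[symmetric] using u by (intro power_decreasing) auto
    thus ?thesis by (intro mult_left_mono) auto
  qed
  also note ge[of n]
  finally have "t ^ n / s n \<le> 1 / n" using pos[of n] n by (simp add: field_simps)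
  thus "0 \<le> monsky (u ^ 2) n" unfolding m[unfolded t_def] using t by (simp flip: t_def)
  have "t ^ n * (n * Suc n) \<le> (real n * u ^ (n - 1)) * (real (Suc n) * u ^ n)"
  proof -
    have "u ^ n \<le> u ^ (n - 1)" using u by (intro power_decreasing) auto
    hence "u ^ n * u ^ n * (n * Suc n) \<le> u ^ (n - 1) * u ^ n * (n * Suc n)"
      using u by (intro mult_right_mono) auto
    thus ?thesis by (simp add: tn algebra_simps)
  qed
  also have "\<dots> \<le> s n * s (Suc n)"
    using ge[of n] ge[of "Suc n"] u pos[of n] n by (intro mult_mono) auto
  finally have *: "t ^ n * real (n * Suc n) \<le> s n * s (Suc n)" by simp
  have "x / P \<le> 1 / m" if "x * m \<le> P" "P > 0" "m > 0" for x P m :: real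
    using that by (simp add: field_simps)
  from this[OF *] have "t ^ n / (s n * s (Suc n)) \<le> 1 / (n * Suc n)"
    using pos[of n] pos[of "Suc n"] n by (metis mult_pos_pos of_nat_0_less_iff zero_less_Suc)
  also have "t ^ n / (s n * s (Suc n)) = t ^ n / s n - t ^ Suc n / s (Suc n)"
  proof -
    have 1: "s (Suc n) = s n + t ^ n" by (simp add: s_def)
    have "s (Suc n) = 1 + t * s n" using t unfolding s by (simp add: field_simps)
    hence "t ^ n * s (Suc n) - t ^ Suc n * s n = t ^ n" by (simp add: algebra_simps)
    thus ?thesis using pos[of n] pos[of "Suc n"] n by (simp add: diff_frac_eq)
  qed
  also have "1 / (n * Suc n) = 1 / n - 1 / Suc n" using n by (simp add: field_simps)
  finally have "1 / Suc n - t ^ Suc n / s (Suc n) \<le> 1 / n - t ^ n / s n" by simp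
  thus "monsky (u ^ 2) (Suc n) \<le> monsky (u ^ 2) n"
    unfolding m[unfolded t_def] using t by (intro divide_right_mono) (auto simp flip: t_def)
qed

context nonprincipal_char
begin

text \<open>A finite form of the comparison with the Lambert series. The second summand of the bound
  accounts for \<open>partial_L K\<close> not yet being 0, the third for cutting each geometric
  series at \<open>d * m \<le> K\<close>; both vanish as \<open>K\<close> grows.\<close>

lemma sum_monsky_le:
  fixes u :: real
  defines "r \<equiv> (\<lambda>n. Re (\<chi> n))" and "t \<equiv> u ^ 2"
  assumes u: "0 < u" "u < 1" and L: "L_value = 0"
  shows   "(\<Sum>m=1..K. (\<Sum>d | d dvd m. r d) * t ^ m) \<le> 2 * N + 2 * N / real (K + 1) / (1 - t) + K * t ^ K / (1 - t)"
proof -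
  have t: "0 < t" "t < 1" using u by (auto simp: t_def power_less_one_iff)
  have tn: "t ^ n \<le> t" if "n > 0" for n
    using that t power_decreasing[of 1 n t] by simp
  have r: "\<bar>r n\<bar> \<le> 1" for n unfolding r_def using abs_Re_le_cmod[of "\<chi> n"] norm_char_le[of n] by simp
  have "norm (\<Sum>n\<in>{1..<Suc K}. \<chi> n * of_real (monsky t n)) \<le> 2 * real N * monsky t 1"
    by (rule norm_sum_mult_antimono_le) (use norm_sum_char_le monsky_bounds[OF u] in \<open>auto simp: t_def\<close>)
  moreover have "monsky t 1 = 1" using t by (simp add: monsky_def field_simps)
  ultimately have "\<bar>Re (\<Sum>n\<in>{1..<Suc K}. \<chi> n * of_real (monsky t n))\<bar> \<le> 2 * N"
    using abs_Re_le_cmod order.trans by fastforce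
  also have "Re (\<Sum>n\<in>{1..<Suc K}. \<chi> n * of_real (monsky t n)) = (\<Sum>n=1..K. r n * monsky t n)"
    by (simp add: r_def atLeastLessThanSuc_atLeastAtMost)
  also have "\<dots> = (\<Sum>n=1..K. r n / n) / (1 - t) - (\<Sum>n=1..K. r n * (t ^ n / (1 - t ^ n)))"
    by (simp add: monsky_def right_diff_distrib sum_subtractf sum_divide_distrib)
  also have "(\<Sum>n=1..K. r n / n) = Re (partial_L K)"
    by (simp add: partial_L_def r_def)
  finally have 1: "(\<Sum>n=1..K. r n * (t ^ n / (1 - t ^ n))) \<le> 2 * N + Re (partial_L K) / (1 - t)"
    by linarith
  have "Re (partial_L K) \<le> 2 * N / real (K + 1)"
    using norm_partial_L_minus_L[of K] complex_Re_le_cmod[of "partial_L K"] L by simp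
  hence 2: "Re (partial_L K) / (1 - t) \<le> 2 * N / real (K + 1) / (1 - t)"
    using t by (intro divide_right_mono) auto
  have "(\<Sum>m=1..K. (\<Sum>d | d dvd m. r d) * t ^ m) = (\<Sum>m=1..K. \<Sum>d | d dvd m. r d * t ^ (d * (m div d)))"
    by (simp add: sum_distrib_right)
  also have "\<dots> = (\<Sum>d=1..K. \<Sum>m=1..K div d. r d * t ^ (d * m))"
    by (rule sum_divisors_swap)
  also have "\<dots> \<le> (\<Sum>d=1..K. r d * (t ^ d / (1 - t ^ d)) + t ^ K / (1 - t))"
  proof (intro sum_mono)
    fix d assume d: "d \<in> {1..K}"
    define q where "q = K div d"
    have td: "t ^ d < 1" "t ^ d \<le> t" using tn[of d] t d by auto
    have "(\<Sum>m=1..q. r d * t ^ (d * m)) = r d * (\<Sum>m=1..q. (t ^ d) ^ m)"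
      by (simp add: sum_distrib_left power_mult)
    also have "(\<Sum>m=1..q. (t ^ d) ^ m) = t ^ d / (1 - t ^ d) - (t ^ d) ^ Suc q / (1 - t ^ d)"
      using td by (cases "q = 0") (simp_all add: sum_gp diff_divide_distrib)
    also have "r d * \<dots> = r d * (t ^ d / (1 - t ^ d)) + (- r d) * ((t ^ d) ^ Suc q / (1 - t ^ d))"
      by (simp add: algebra_simps)
    also have "(- r d) * ((t ^ d) ^ Suc q / (1 - t ^ d)) \<le> 1 * ((t ^ d) ^ Suc q / (1 - t ^ d))"
      using r[of d] td t by (intro mult_right_mono) auto
    also have "\<dots> \<le> t ^ K / (1 - t)"
    proof -
      \<comment> \<open>The first omitted exponent \<open>d * (q + 1)\<close> exceeds
        \<open>K\<close>, so the omitted tail is at most \<open>t ^ K / (1 - t)\<close>.\<close>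
      have "K \<le> d * Suc q" using dividend_less_times_div[of d K] d by (auto simp: q_def)
      hence "(t ^ d) ^ Suc q \<le> t ^ K" unfolding power_mult[symmetric] using t by (intro power_decreasing) auto
      thus ?thesis unfolding mult_1 using td t by (intro frac_le) auto
    qed
    finally show "(\<Sum>m=1..K div d. r d * t ^ (d * m)) \<le> r d * (t ^ d / (1 - t ^ d)) + t ^ K / (1 - t)"
      by (simp add: q_def)
  qed
  also have "\<dots> = (\<Sum>d=1..K. r d * (t ^ d / (1 - t ^ d))) + K * t ^ K / (1 - t)"
    by (simp add: sum.distrib)
  finally show ?thesis using 1 2 by linarith
qed

lemma L_value_nonzero_if_real:
  assumes real: "\<And>n. cnj (\<chi> n) = \<chi> n"
  shows   "L_value \<noteq> 0"
proof
  assume L: "L_value = 0"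
  define r where "r = (\<lambda>n. Re (\<chi> n))"
  define c where "c m = (\<Sum>d | d dvd m. r d)" for m
  have \<chi>: "\<chi> n = of_real (r n)" for n
    using real[of n] by (simp add: r_def complex_eq_iff)
  have mult: "r (x * y) = r x * r y" for x y
    using char_mult[of x y] unfolding \<chi> by (simp flip: of_real_mult)
  have "r n \<in> {-1, 0, 1}" for n
    using norm_dirichlet_char[OF N dirichlet, of n] unfolding \<chi> by (auto simp: abs_if of_bool_def split: if_splits)
  moreover have "r 1 = 1" using dirichlet by (simp add: r_def)
  ultimately have c: "c m \<ge> of_bool (\<exists>k. m = k ^ 2)" if "m > 0" for m
    unfolding c_def using mult that by (intro sum_divisors_real_char_nonneg) auto
  \<comment> \<open>\<open>M\<close> is chosen so that \<open>M / 2 > 2 * N\<close>. By Bernoulli's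
    inequality, \<open>u\<close> is close enough to 1 that \<open>t ^ (M ^ 2) \<ge> 1 / 2\<close>;
    thus each of the squares up to \<open>M ^ 2\<close> contributes at least one half, and letting
    \<open>K\<close> grow contradicts the bound \<open>2 * N\<close>.\<close>
  define M where "M = 4 * N + 1"
  define u where "u = 1 - 1 / (4 * real M ^ 2)"
  define t where "t = u ^ 2"
  have M: "M > 0" by (simp add: M_def)
  hence "1 / (4 * real M ^ 2) < 1" by (simp add: field_simps) (smt (verit) one_le_power of_nat_1 of_nat_le_iff Suc_leI One_nat_def)
  hence u: "0 < u" "u < 1" using M by (auto simp: u_def)
  hence t: "0 < t" "t < 1" by (auto simp: t_def power_less_one_iff)
  have "1 + real (2 * M ^ 2) * (- (1 / (4 * real M ^ 2))) \<le> (1 + (- (1 / (4 * real M ^ 2)))) ^ (2 * M ^ 2)"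
    using u by (intro Bernoulli_inequality) (simp add: u_def)
  hence half: "1 / 2 \<le> t ^ (M ^ 2)" using M by (simp add: t_def u_def power_mult)
  have "M * (1 / 2) \<le> 2 * N + 2 * N / real (K + 1) / (1 - t) + K * t ^ K / (1 - t)" if K: "K \<ge> M ^ 2" for K
  proof -
    have "M * (1 / 2) = (\<Sum>i=1..M. 1 / 2 :: real)" by simp
    also have "\<dots> \<le> (\<Sum>i=1..M. t ^ (i ^ 2))"
    proof (intro sum_mono order.trans[OF half])
      fix i assume "i \<in> {1..M}"
      thus "t ^ M ^ 2 \<le> t ^ i ^ 2" using t by (intro power_decreasing power_mono) auto
    qed
    also have "\<dots> \<le> (\<Sum>i=1..M. c (i ^ 2) * t ^ (i ^ 2))"
    proof (intro sum_mono)
      fix i assume "i \<in> {1..M}"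
      hence "1 \<le> c (i ^ 2)" using c[of "i ^ 2"] by auto
      thus "t ^ i ^ 2 \<le> c (i ^ 2) * t ^ (i ^ 2)" using t mult_right_mono[of 1 "c (i ^ 2)" "t ^ i ^ 2"] by simp
    qed
    also have "\<dots> = (\<Sum>m\<in>(\<lambda>i. i ^ 2) ` {1..M}. c m * t ^ m)"
      by (subst sum.reindex) (auto simp: inj_on_def)
    also have "\<dots> \<le> (\<Sum>m=1..K. c m * t ^ m)"
    proof (intro sum_mono2)
      show "(\<lambda>i. i ^ 2) ` {1..M} \<subseteq> {1..K}"
        using K by (auto intro: order.trans[OF power_mono])
      show "0 \<le> c m * t ^ m" if "m \<in> {1..K} - (\<lambda>i. i ^ 2) ` {1..M}" for m
        using that t c[of m] by (intro mult_nonneg_nonneg) (auto intro: order.trans[rotated])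
    qed auto
    also have "\<dots> \<le> 2 * N + 2 * N / real (K + 1) / (1 - t) + K * t ^ K / (1 - t)"
      unfolding c_def r_def t_def by (rule sum_monsky_le[OF u L])
    finally show ?thesis .
  qed
  moreover have "(\<lambda>K. 2 * N + 2 * N / real (K + 1) / (1 - t) + K * t ^ K / (1 - t)) \<longlonglongrightarrow>
      2 * N + 0 / (1 - t) + 0 / (1 - t)"
    using t powser_times_n_limit_0[of t]
    by (intro tendsto_intros LIMSEQ_Suc[OF lim_const_over_n, unfolded Suc_eq_plus1]) auto
  ultimately have "M * (1 / 2) \<le> 2 * N + 0 / (1 - t) + 0 / (1 - t)"
    by (intro LIMSEQ_le_const) blast+
  thus False by (simp add: M_def)
qed

end

section \<open>Dirichlet's theorem\<close>

text \<open>If the L-value vanished for \<open>\<chi>\<close>, then also for its conjugate, which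
  differs from \<open>\<chi>\<close> by the real case. In the non-negative sum over all characters
  these two contribute at most \<open>4 * N - 2 * ln X\<close>, the principal one at most
  \<open>ln X + 4\<close> and the others a bounded amount, which fails for large
  \<open>X\<close>.\<close>

theorem L_value_nonzero:
  assumes "nonprincipal_char N \<chi>"
  shows   "nonprincipal_char.L_value \<chi> \<noteq> 0"
proof
  interpret nonprincipal_char N \<chi> by fact
  assume L: "L_value = 0"
  define \<psi> where "\<psi> = (\<lambda>n. cnj (\<chi> n))"
  have "\<psi> \<noteq> principal_char N"
  proof
    assume "\<psi> = principal_char N"
    hence "\<chi> n = principal_char N n" for n
      by (metis \<psi>_def complex_cnj_cnj complex_cnj_one complex_cnj_zero of_bool_eq principal_char_def)
    with nonprincipal show False by blast
  qed
  then interpret \<psi>: nonprincipal_char N \<psi>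
    by unfold_locales (use N dirichlet dirichlet_char_cnj in \<open>auto simp: \<psi>_def\<close>)
  have "\<psi>.partial_L y = cnj (partial_L y)" for y
    unfolding \<psi>.partial_L_def partial_L_def by (simp add: \<psi>_def)
  hence "\<psi>.partial_L = (\<lambda>y. cnj (partial_L y))" by (rule ext)
  hence "\<psi>.partial_L \<longlonglongrightarrow> cnj 0"
    using tendsto_cnj[OF partial_L_tendsto] L by simp
  hence L': "\<psi>.L_value = 0" using \<psi>.partial_L_tendsto LIMSEQ_unique by fastforce
  have "\<psi> \<noteq> \<chi>" using L_value_nonzero_if_real L unfolding \<psi>_def by metis

  let ?D = "{\<chi>. dirichlet_char N \<chi>}"
  let ?D' = "?D - {principal_char N, \<chi>, \<psi>}"
  define S where "S \<phi> X = Re (\<Sum>n=1..X. \<phi> n * mangoldt n / n)" for \<phi> :: "nat \<Rightarrow> complex" and X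
  have "\<forall>\<phi>\<in>?D'. \<exists>C. \<forall>X>0. S \<phi> X \<le> C"
  proof
    fix \<phi> assume "\<phi> \<in> ?D'"
    then interpret \<phi>: nonprincipal_char N \<phi> by unfold_locales (use N in auto)
    show "\<exists>C. \<forall>X>0. S \<phi> X \<le> C"
      using \<phi>.Re_mangoldt_sum_bounded unfolding S_def \<phi>.mangoldt_sum_def .
  qed
  then obtain C where C: "\<And>\<phi> X. \<phi> \<in> ?D' \<Longrightarrow> X > 0 \<Longrightarrow> S \<phi> X \<le> C \<phi>" by metis
  have le: "S \<chi> X \<le> 2 * N - ln X" "S \<psi> X \<le> 2 * N - ln X" if "X > 0" for X
    using mangoldt_sum_if_L_eq_0[OF L that] \<psi>.mangoldt_sum_if_L_eq_0[OF L' that]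
      complex_Re_le_cmod[of "ln X + mangoldt_sum X"] complex_Re_le_cmod[of "ln X + \<psi>.mangoldt_sum X"]
    by (simp_all add: S_def mangoldt_sum_def \<psi>.mangoldt_sum_def)
  have fin: "finite ?D" by (rule finite_dirichlet_chars[OF N])
  have bound: "ln X \<le> 4 + 4 * N + (\<Sum>\<phi>\<in>?D'. C \<phi>)" if X: "X > 0" for X :: nat
  proof -
    have "(\<Sum>\<phi>\<in>?D. S \<phi> X) = Re (\<Sum>n=1..X. (\<Sum>\<phi>\<in>?D. \<phi> n) * mangoldt n / n)"
      unfolding S_def Re_sum[symmetric] sum_distrib_right sum_divide_distrib by (subst sum.swap) simp
    also have "\<dots> = (\<Sum>n=1..X. (if [n = 1] (mod N) then card ?D else 0) * mangoldt n / n)"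
      unfolding sum_over_dirichlet_chars[OF N] by (auto intro!: sum.cong)
    also have "\<dots> \<ge> 0" by (intro sum_nonneg) (auto intro!: divide_nonneg_nonneg mult_nonneg_nonneg mangoldt_nonneg)
    finally have "0 \<le> (\<Sum>\<phi>\<in>?D. S \<phi> X)" .
    also have "?D = insert (principal_char N) (insert \<chi> (insert \<psi> ?D'))"
      using dirichlet \<psi>.dirichlet dirichlet_char_principal by auto
    also have "(\<Sum>\<phi>\<in>\<dots>. S \<phi> X) = S (principal_char N) X + (S \<chi> X + (S \<psi> X + (\<Sum>\<phi>\<in>?D'. S \<phi> X)))"
      using fin nonprincipal \<psi>.nonprincipal \<open>\<psi> \<noteq> \<chi>\<close> by (subst sum.insert; simp)+
    also have "(\<Sum>\<phi>\<in>?D'. S \<phi> X) \<le> (\<Sum>\<phi>\<in>?D'. C \<phi>)" using C X by (intro sum_mono) auto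
    also have "S (principal_char N) X = (\<Sum>n=1..X. of_bool (coprime n N) * mangoldt n / n)"
      by (auto simp: S_def principal_char_def intro!: sum.cong)
    also have "\<dots> \<le> (\<Sum>n=1..X. mangoldt n / n)"
      by (intro sum_mono divide_right_mono mult_left_le_one_le) (auto simp: mangoldt_nonneg)
    also have "\<dots> \<le> ln X + 4" by (rule sum_mangoldt_over_n[OF X])
    finally show ?thesis using le[OF X] by simp
  qed
  define K where "K = 4 + 4 * N + (\<Sum>\<phi>\<in>?D'. C \<phi>)"
  obtain X :: nat where X: "real X > exp K" using reals_Archimedean2 by blast
  have X0: "X > 0" using X exp_gt_zero[of K] by (metis of_nat_0_less_iff order.strict_trans)
  hence "ln X > K" using X by (metis exp_gt_zero ln_exp ln_less_cancel_iff of_nat_0_less_iff)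
  with bound[OF X0] show False by (simp add: K_def)
qed

text \<open>By orthogonality, the sum of \<open>mangoldt n / n\<close> over the residue class,
  multiplied by the number of characters, is at least \<open>ln X\<close> minus a constant: only the
  principal character is unbounded. Finitely many primes, together with the bounded contribution of
  non-primes, could not reach this.\<close>

theorem dirichlet_infinite_primes:
  fixes a N :: nat
  assumes N: "N > 0" and a: "coprime a N"
  shows   "infinite {p. prime p \<and> [p = a] (mod N)}"
proof
  let ?P = "{p. prime p \<and> [p = a] (mod N)}"
  let ?D = "{\<chi>. dirichlet_char N \<chi>}"
  let ?D' = "?D - {principal_char N}"
  assume finP: "finite ?P"
  define S where "S \<phi> X = (\<Sum>n=1..X. \<phi> n * mangoldt n / n)" for \<phi> :: "nat \<Rightarrow> complex" and X
  have "\<forall>\<phi>\<in>?D'. \<exists>C. \<forall>X>0. norm (S \<phi> X) \<le> C"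
  proof
    fix \<phi> assume "\<phi> \<in> ?D'"
    then interpret \<phi>: nonprincipal_char N \<phi> by unfold_locales (use N in auto)
    show "\<exists>C. \<forall>X>0. norm (S \<phi> X) \<le> C"
      using \<phi>.mangoldt_sum_bounded L_value_nonzero[OF \<phi>.nonprincipal_char_axioms]
      unfolding S_def \<phi>.mangoldt_sum_def by blast
  qed
  then obtain C where C: "\<And>\<phi> X. \<phi> \<in> ?D' \<Longrightarrow> X > 0 \<Longrightarrow> norm (S \<phi> X) \<le> C \<phi>" by metis
  have fin: "finite ?D" by (rule finite_dirichlet_chars[OF N])
  define K1 where "K1 = (\<Sum>p\<in>prime_factors N. 2 * ln p / real p)"
  define K2 where "K2 = 4 + (\<Sum>p\<in>?P. mangoldt p / real p)"
  define K where "K = card ?D * K2 + (\<Sum>\<phi>\<in>?D'. C \<phi>) + K1 + 1"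
  have bound: "ln X \<le> K" if X: "X > 0" for X :: nat
  proof -
    define T where "T = (\<Sum>n | n \<in> {1..X} \<and> [n = a] (mod N). mangoldt n / n :: real)"
    have "(\<Sum>\<phi>\<in>?D. cnj (\<phi> a) * S \<phi> X) = (\<Sum>n=1..X. (\<Sum>\<phi>\<in>?D. cnj (\<phi> a) * \<phi> n) * mangoldt n / n)"
      unfolding S_def sum_distrib_right sum_divide_distrib sum_distrib_left
      by (subst sum.swap) (simp add: mult.assoc)
    also have "\<dots> = (\<Sum>n=1..X. if [n = a] (mod N) then of_real (card ?D * (mangoldt n / n)) else 0)"
      unfolding dirichlet_char_orthogonality[OF N a] by (intro sum.cong) auto
    also have "\<dots> = of_real (card ?D * T)"
      by (simp add: T_def sum_distrib_left sum.inter_filter flip: sum.inter_filter)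
    finally have eq: "card ?D * T = Re (\<Sum>\<phi>\<in>?D. cnj (\<phi> a) * S \<phi> X)" by simp
    have "(\<Sum>\<phi>\<in>?D. cnj (\<phi> a) * S \<phi> X) =
        cnj (principal_char N a) * S (principal_char N) X + (\<Sum>\<phi>\<in>?D'. cnj (\<phi> a) * S \<phi> X)"
      using fin dirichlet_char_principal by (subst sum.remove[of _ "principal_char N"]) auto
    moreover have "cnj (principal_char N a) = 1" using a by (simp add: principal_char_def)
    moreover have "norm (\<Sum>\<phi>\<in>?D'. cnj (\<phi> a) * S \<phi> X) \<le> (\<Sum>\<phi>\<in>?D'. C \<phi>)"
      using C[OF _ X] a norm_dirichlet_char[OF N] by (intro sum_norm_le) (auto simp: norm_mult)
    hence "Re (\<Sum>\<phi>\<in>?D'. cnj (\<phi> a) * S \<phi> X) \<ge> - (\<Sum>\<phi>\<in>?D'. C \<phi>)"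
      using abs_Re_le_cmod[of "\<Sum>\<phi>\<in>?D'. cnj (\<phi> a) * S \<phi> X"] by linarith
    ultimately have 1: "card ?D * T \<ge> Re (S (principal_char N) X) - (\<Sum>\<phi>\<in>?D'. C \<phi>)"
      unfolding eq by simp
    have "Re (S (principal_char N) X) = (\<Sum>n=1..X. of_bool (coprime n N) * mangoldt n / n)"
      by (auto simp: S_def principal_char_def intro!: sum.cong)
    also have "\<dots> = (\<Sum>n=1..X. mangoldt n / n - (if \<not> coprime n N then mangoldt n / n else 0))"
      by (intro sum.cong) auto
    also have "\<dots> = (\<Sum>n=1..X. mangoldt n / n) - (\<Sum>n | n \<in> {1..X} \<and> \<not> coprime n N. mangoldt n / n)"
      unfolding sum_subtractf by (subst sum.inter_filter) auto
    also have "\<dots> \<ge> (ln X - 1) - K1"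
      unfolding K1_def by (intro diff_mono sum_mangoldt_over_n X sum_mangoldt_not_coprime_le N)
    finally have 2: "Re (S (principal_char N) X) \<ge> ln X - 1 - K1" .
    have "T \<le> (\<Sum>n\<in>{n. n \<in> {1..X} \<and> \<not> prime n} \<union> ?P. mangoldt n / n)"
      unfolding T_def using finP by (intro sum_mono2) (auto intro!: divide_nonneg_nonneg mangoldt_nonneg)
    also have "\<dots> = (\<Sum>n | n \<in> {1..X} \<and> \<not> prime n. mangoldt n / n) + (\<Sum>n\<in>?P. mangoldt n / n)"
      using finP by (intro sum.union_disjoint) auto
    also have "\<dots> \<le> K2" unfolding K2_def using sum_mangoldt_nonprime_le[of X] by simp
    finally have "card ?D * T \<le> card ?D * K2" by (intro mult_left_mono) auto
    with 1 2 show ?thesis by (simp add: K_def)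
  qed
  obtain X :: nat where X: "real X > exp K" using reals_Archimedean2 by blast
  have X0: "X > 0" using X exp_gt_zero[of K] by (metis of_nat_0_less_iff order.strict_trans)
  hence "ln X > K" using X by (metis exp_gt_zero ln_exp ln_less_cancel_iff of_nat_0_less_iff)
  with bound[OF X0] show False by simp
qed

section \<open>The linear recurrence modulo a prime\<close>

text \<open>
  With \<open>E\<close> the shift, this is \<open>2 * E - z\<close>. On solutions of the recurrence its square is multiplication by \<open>z\<^sup>2 - 4\<close>,
  while modulo \<open>p\<close> its \<open>p\<close>-th power is \<open>2 * E ^ p - z\<close>; comparing the two expresses \<open>E ^ p\<close> through \<open>E\<close>.
\<close>

definition shift_op :: "int \<Rightarrow> (nat \<Rightarrow> int) \<Rightarrow> nat \<Rightarrow> int" where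
  "shift_op z s k = 2 * s (k + 1) - z * s k"

text \<open>The binomial theorem for the commuting operators \<open>2 * E\<close> and
  \<open>- z\<close>, by Pascal's rule.\<close>

lemma funpow_shift_op:
  "(shift_op z ^^ n) s k = (\<Sum>i\<le>n. int (n choose i) * 2 ^ i * (-z) ^ (n - i) * s (k + i))"
proof (induction n arbitrary: k)
  case (Suc n)
  define a where "a i = 2 ^ i * (-z) ^ (Suc n - i) * s (k + i)" for i
  have "(\<Sum>i\<le>Suc n. int (Suc n choose i) * 2 ^ i * (-z) ^ (Suc n - i) * s (k + i)) =
          (\<Sum>i\<le>Suc n. int (Suc n choose i) * a i)"
    by (simp add: a_def mult.assoc)
  also have "\<dots> = (\<Sum>i\<le>n. int (n choose i) * a (Suc i)) + (a 0 + (\<Sum>i\<le>n. int (n choose Suc i) * a (Suc i)))"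
    by (subst sum.atMost_Suc_shift) (simp add: algebra_simps sum.distrib)
  also have "a 0 + (\<Sum>i\<le>n. int (n choose Suc i) * a (Suc i)) = (\<Sum>i\<le>Suc n. int (n choose i) * a i)"
    by (subst sum.atMost_Suc_shift) simp
  also have "\<dots> = (\<Sum>i\<le>n. int (n choose i) * a i)" by simp
  also have "\<dots> = - z * (shift_op z ^^ n) s k"
    unfolding Suc.IH sum_distrib_left by (intro sum.cong) (auto simp: a_def Suc_diff_le mult_ac)
  also have "(\<Sum>i\<le>n. int (n choose i) * a (Suc i)) = 2 * (shift_op z ^^ n) s (k + 1)"
    unfolding Suc.IH sum_distrib_left by (intro sum.cong) (auto simp: a_def mult_ac)
  finally have "(\<Sum>i\<le>Suc n. int (Suc n choose i) * 2 ^ i * (-z) ^ (Suc n - i) * s (k + i)) =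
    2 * (shift_op z ^^ n) s (k + 1) - z * (shift_op z ^^ n) s k" by simp
  moreover have "(shift_op z ^^ Suc n) s k = 2 * (shift_op z ^^ n) s (k + 1) - z * (shift_op z ^^ n) s k"
    by (simp add: shift_op_def[of z "(shift_op z ^^ n) s"])
  ultimately show ?case by (simp only:)
qed simp

lemma fermat_int:
  fixes a :: int
  assumes "prime (p::nat)"
  shows   "[a ^ p = a] (mod p)"
proof -
  define b where "b = nat (a mod p)"
  have p: "p > 0" using assms by (simp add: prime_gt_0_nat)
  hence b: "[a = int b] (mod p)" by (simp add: b_def cong_def)
  have "[b ^ p = b] (mod p)"
  proof (cases "p dvd b")
    case True
    thus ?thesis using p by (metis cong_0_iff cong_sym cong_trans dvd_power_same dvd_trans dvd_power)
  next
    case False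
    have "[b * b ^ (p - 1) = b * 1] (mod p)"
      by (intro cong_mult cong_refl fermat_theorem assms False)
    thus ?thesis using p by (simp flip: power_Suc)
  qed
  hence "[int b ^ p = int b] (mod p)" by (metis cong_int_iff of_nat_power)
  thus ?thesis using b by (meson cong_pow cong_sym cong_trans)
qed

locale markoff_seq =
  fixes p :: nat and z :: int and s :: "nat \<Rightarrow> int"
  assumes prime: "prime p" and odd: "p > 2"
    and rec: "[s (k + 2) = z * s (k + 1) - s k] (mod p)"
begin

lemma cancel_2:
  fixes a b :: int
  assumes "[2 * a = 2 * b] (mod p)"
  shows   "[a = b] (mod p)"
proof -
  have "odd p" using prime odd prime_odd_nat by auto
  hence "coprime 2 (int p)" by simp
  thus ?thesis using assms cong_mult_lcancel by blast
qed

lemma funpow_shift_op_even: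
  "[(shift_op z ^^ (2 * j)) s k = (z\<^sup>2 - 4) ^ j * s k] (mod p)"
proof -
  define Rec where "Rec u \<longleftrightarrow> (\<forall>k. [u (k + 2) = z * u (k + 1) - u k] (mod p))" for u :: "nat \<Rightarrow> int"
  have step: "Rec (shift_op z u)" if "Rec u" for u
    unfolding Rec_def
  proof
    fix k
    have "[2 * u (k + 1 + 2) - z * u (k + 2) = 2 * (z * u (k + 1 + 1) - u (k + 1)) - z * (z * u (k + 1) - u k)] (mod p)"
      using that unfolding Rec_def by (intro cong_diff cong_mult cong_refl) blast+
    thus "[shift_op z u (k + 2) = z * shift_op z u (k + 1) - shift_op z u k] (mod p)"
      by (simp add: shift_op_def algebra_simps)
  qed
  have twice: "[shift_op z (shift_op z u) k = (z\<^sup>2 - 4) * u k] (mod p)" if "Rec u" for u k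
  proof -
    have "[4 * u (k + 2) - 4 * z * u (k + 1) + z\<^sup>2 * u k = 4 * (z * u (k + 1) - u k) - 4 * z * u (k + 1) + z\<^sup>2 * u k] (mod p)"
      using that unfolding Rec_def by (intro cong_diff cong_add cong_mult cong_refl) blast+
    thus ?thesis by (simp add: shift_op_def algebra_simps power2_eq_square)
  qed
  have rec': "Rec ((shift_op z ^^ n) s)" for n
    by (induction n) (use rec step in \<open>auto simp: Rec_def\<close>)
  show ?thesis
  proof (induction j)
    case (Suc j)
    have "[shift_op z (shift_op z ((shift_op z ^^ (2 * j)) s)) k = (z\<^sup>2 - 4) * (shift_op z ^^ (2 * j)) s k] (mod p)"
      by (rule twice[OF rec'])
    also have "[(z\<^sup>2 - 4) * (shift_op z ^^ (2 * j)) s k = (z\<^sup>2 - 4) * ((z\<^sup>2 - 4) ^ j * s k)] (mod p)"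
      by (intro cong_mult cong_refl Suc)
    finally show ?case by (simp add: mult.assoc)
  qed auto
qed

lemma shift_op_p:
  "[2 * s (k + p) - z * s k = (z\<^sup>2 - 4) ^ ((p - 1) div 2) * (2 * s (k + 1) - z * s k)] (mod p)"
proof -
  define j where "j = (p - 1) div 2"
  have "odd p" using prime odd prime_odd_nat by auto
  hence j: "p = Suc (2 * j)" by (auto simp: j_def elim!: oddE)
  let ?a = "\<lambda>i. int (p choose i) * 2 ^ i * (-z) ^ (p - i) * s (k + i)"
  have "(shift_op z ^^ p) s k = (\<Sum>i\<le>p. ?a i)" by (rule funpow_shift_op)
  also have "\<dots> = ?a 0 + ?a p + (\<Sum>i\<in>{0<..<p}. ?a i)"
  proof -
    have "{..p} = insert 0 (insert p {0<..<p})" by auto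
    thus ?thesis using odd by simp
  qed
  finally have "[(shift_op z ^^ p) s k = (-z) ^ p * s k + 2 ^ p * s (k + p)] (mod p)"
  proof -
    have "int p dvd (\<Sum>i\<in>{0<..<p}. ?a i)"
    proof (intro dvd_sum dvd_mult2)
      fix i assume "i \<in> {0<..<p}"
      thus "int p dvd int (p choose i)" using dvd_choose_prime[of i p] prime by simp
    qed
    moreover assume "(shift_op z ^^ p) s k = ?a 0 + ?a p + (\<Sum>i\<in>{0<..<p}. ?a i)"
    ultimately show ?thesis by (simp add: cong_iff_dvd_diff)
  qed
  also have "[(-z) ^ p * s k + 2 ^ p * s (k + p) = (-z) * s k + 2 * s (k + p)] (mod p)"
    by (intro cong_add cong_mult cong_refl fermat_int prime)
  finally have 1: "[(shift_op z ^^ p) s k = 2 * s (k + p) - z * s k] (mod p)" by simp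
  have "(shift_op z ^^ p) s k = 2 * (shift_op z ^^ (2 * j)) s (k + 1) - z * (shift_op z ^^ (2 * j)) s k"
    by (subst j) (simp add: shift_op_def)
  also have "[\<dots> = 2 * ((z\<^sup>2 - 4) ^ j * s (k + 1)) - z * ((z\<^sup>2 - 4) ^ j * s k)] (mod p)"
    by (intro cong_diff cong_mult cong_refl funpow_shift_op_even)
  finally have "[(shift_op z ^^ p) s k = (z\<^sup>2 - 4) ^ j * (2 * s (k + 1) - z * s k)] (mod p)"
    by (simp add: algebra_simps)
  thus ?thesis using 1 unfolding j_def by (meson cong_sym cong_trans)
qed

text \<open>Euler's criterion turns \<open>(z\<^sup>2 - 4) ^ ((p - 1) div 2)\<close> into a Legendre
  symbol. Its values 1, -1 and 0 mean, respectively, \<open>E ^ p = E\<close>,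
  \<open>E ^ p = z - E\<close>, which is the inverse of \<open>E\<close>, and
  \<open>2 * E ^ p = z\<close>, whose square is \<open>4 * E ^ (2 * p) = 4\<close>.\<close>

lemma period_cases:
  obtains (minus) "\<not> [z\<^sup>2 = 4] (mod p)" "\<And>k. [s (k + (p - 1)) = s k] (mod p)"
  | (plus) "\<not> [z\<^sup>2 = 4] (mod p)" "\<And>k. [s (k + (p + 1)) = s k] (mod p)"
  | (degenerate) "[z\<^sup>2 = 4] (mod p)" "\<And>k. [s (k + 2 * p) = s k] (mod p)"
proof -
  define D where "D = z\<^sup>2 - 4"
  have "[Legendre D p = D ^ ((p - 1) div 2)] (mod p)"
    using euler_criterion prime odd by blast
  hence main: "[2 * s (k + p) - z * s k = Legendre D p * (2 * s (k + 1) - z * s k)] (mod p)" for k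
    using shift_op_p[of k] unfolding D_def by (meson cong_scalar_right cong_sym cong_trans)
  have D: "[D = 0] (mod p) \<longleftrightarrow> [z\<^sup>2 = 4] (mod p)" by (simp add: D_def cong_iff_dvd_diff)
  have nz: "\<not> [z\<^sup>2 = 4] (mod p)" if "Legendre D p \<noteq> 0"
    using that unfolding D[symmetric] by (auto simp: Legendre_def)
  have "Legendre D p \<in> {0, 1, -1}" by (simp add: Legendre_def)
  then consider "Legendre D p = 1" | "Legendre D p = -1" | "Legendre D p = 0" by auto
  thus ?thesis
  proof cases
    assume L: "Legendre D p = 1"
    have *: "[s (k + p) = s (k + 1)] (mod p)" for k
    proof (rule cancel_2)
      show "[2 * s (k + p) = 2 * s (k + 1)] (mod p)"
        using cong_add[OF main[of k] cong_refl[of "z * s k"]] L by simp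
    qed
    have "[s (k + (p - 1)) = s k] (mod p)" for k
    proof -
      \<comment> \<open>The recurrence run backwards, which allows one shift to be
        cancelled.\<close>
      have prev: "[s n = z * s (n + 1) - s (n + 2)] (mod p)" for n
        using cong_diff[OF cong_refl[of "z * s (n + 1)"] rec[of n]] by (simp add: cong_sym)
      have "[s (k + (p - 1)) = z * s (k + p) - s (k + 1 + p)] (mod p)"
        using prev[of "k + (p - 1)"] odd by (simp add: add_ac)
      also have "[z * s (k + p) - s (k + 1 + p) = z * s (k + 1) - s (k + 1 + 1)] (mod p)"
        by (intro cong_diff cong_mult cong_refl *)
      also have "[z * s (k + 1) - s (k + 1 + 1) = s k] (mod p)"
        using cong_sym[OF prev[of k]] by simp
      finally show ?thesis .
    qed
    thus ?thesis using nz L by (intro minus) simp_all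
  next
    assume L: "Legendre D p = -1"
    have *: "[s (k + p) = z * s k - s (k + 1)] (mod p)" for k
    proof (rule cancel_2)
      show "[2 * s (k + p) = 2 * (z * s k - s (k + 1))] (mod p)"
        using cong_add[OF main[of k] cong_refl[of "z * s k"]] L by (simp add: algebra_simps)
    qed
    have "[s (k + (p + 1)) = s k] (mod p)" for k
    proof -
      have "[s (k + 1 + p) = z * s (k + 1) - s (k + 2)] (mod p)"
        using *[of "k + 1"] by simp
      also have "[z * s (k + 1) - s (k + 2) = z * s (k + 1) - (z * s (k + 1) - s k)] (mod p)"
        by (intro cong_diff cong_refl rec)
      finally show ?thesis by (simp add: add_ac)
    qed
    thus ?thesis using nz L by (intro plus) simp_all
  next
    assume L: "Legendre D p = 0"
    hence "[D = 0] (mod p)" by (auto simp: Legendre_def split: if_splits)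
    hence z: "[z\<^sup>2 = 4] (mod p)" by (simp only: D)
    have *: "[2 * s (k + p) = z * s k] (mod p)" for k
      using cong_add[OF main[of k] cong_refl[of "z * s k"]] L by simp
    have "[s (k + 2 * p) = s k] (mod p)" for k
    proof (rule cancel_2, rule cancel_2)
      have "[2 * (2 * s (k + p + p)) = 2 * (z * s (k + p))] (mod p)"
        by (intro cong_mult cong_refl *)
      also have "2 * (z * s (k + p)) = z * (2 * s (k + p))" by simp
      also have "[z * (2 * s (k + p)) = z * (z * s k)] (mod p)" by (intro cong_mult cong_refl *)
      also have "z * (z * s k) = z\<^sup>2 * s k" by (simp add: power2_eq_square)
      also have "[z\<^sup>2 * s k = 4 * s k] (mod p)" by (intro cong_mult cong_refl z)
      finally have "[2 * (2 * s (k + p + p)) = 4 * s k] (mod p)" .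
      moreover have "k + p + p = k + 2 * p" "4 * s k = 2 * (2 * s k)" by simp_all
      ultimately show "[2 * (2 * s (k + 2 * p)) = 2 * (2 * s k)] (mod p)" by (simp only:)
    qed
    with z show ?thesis by (rule degenerate)
  qed
qed

section \<open>Periods of the sequence\<close>

definition period :: "nat \<Rightarrow> bool" where
  "period d \<longleftrightarrow> (\<forall>k. [s (k + d) = s k] (mod p))"

lemma period_mult: "period d \<Longrightarrow> period (d * m)"
proof (induction m)
  case (Suc m)
  have "[s (k + d * m + d) = s k] (mod p)" for k
    using Suc unfolding period_def by (meson cong_trans)
  thus ?case by (simp add: period_def add_ac)
qed (simp add: period_def)

lemma period_dvd: "period d \<Longrightarrow> d dvd e \<Longrightarrow> period e"
  using period_mult by auto

lemma period_gcd:
  assumes "period a" "period b"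
  shows   "period (gcd a b)"
proof (cases "a = 0")
  case False
  \<comment> \<open>This subtraction-free form of Bezout's identity compares the shifts by
    \<open>a * x\<close> and by \<open>b * y + gcd a b\<close> without negative indices.\<close>
  then obtain x y where xy: "a * x = b * y + gcd a b" using bezout_nat by blast
  have "[s (k + gcd a b) = s k] (mod p)" for k
  proof -
    have "[s (k + gcd a b + b * y) = s (k + gcd a b)] (mod p)"
      using period_mult[OF assms(2)] unfolding period_def by blast
    moreover have "[s (k + a * x) = s k] (mod p)"
      using period_mult[OF assms(1)] unfolding period_def by blast
    moreover have "k + gcd a b + b * y = k + a * x" using xy by simp
    ultimately show ?thesis by (metis cong_sym cong_trans)
  qed
  thus ?thesis by (simp add: period_def)
qed (use assms in simp)

lemma period_if:
  assumes "[s d = s 0] (mod p)" "[s (d + 1) = s 1] (mod p)"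
  shows   "period d"
proof -
  have "[s (k + d) = s k] (mod p) \<and> [s (k + 1 + d) = s (k + 1)] (mod p)" for k
  proof (induction k)
    case (Suc k)
    have "[s (k + d + 2) = z * s (k + d + 1) - s (k + d)] (mod p)" by (rule rec)
    also have "[z * s (k + d + 1) - s (k + d) = z * s (k + 1) - s k] (mod p)"
      using Suc by (intro cong_diff cong_mult cong_refl) (auto simp: add_ac)
    also have "[z * s (k + 1) - s k = s (k + 2)] (mod p)" by (rule cong_sym[OF rec])
    finally show ?case using Suc by (simp add: add_ac)
  qed (use assms in \<open>auto simp: add_ac\<close>)
  thus ?thesis by (simp add: period_def)
qed

text \<open>The coefficients are the Chebyshev polynomials of the second kind evaluated at
  \<open>z / 2\<close>.\<close>

lemma seq_values:
  "[s 2 = z * s 1 - s 0] (mod p)"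
  "[s 3 = (z^2 - 1) * s 1 - z * s 0] (mod p)"
  "[s 4 = (z^3 - 2 * z) * s 1 - (z^2 - 1) * s 0] (mod p)"
  "[s 5 = (z^4 - 3 * z^2 + 1) * s 1 - (z^3 - 2 * z) * s 0] (mod p)"
  "[s 6 = (z^5 - 4 * z^3 + 3 * z) * s 1 - (z^4 - 3 * z^2 + 1) * s 0] (mod p)"
  "[s 7 = (z^6 - 5 * z^4 + 6 * z^2 - 1) * s 1 - (z^5 - 4 * z^3 + 3 * z) * s 0] (mod p)"
proof -
  have step: "[s l = c] (mod p)"
    if "[s m = a] (mod p)" "[s k = b] (mod p)" "m = k + 1" "l = k + 2" "z * a - b = c" for a b c k l m
    using cong_trans[OF rec[of k] cong_diff[OF cong_mult[OF cong_refl that(1)[unfolded that(3)]] that(2)]] that(4,5) by simp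
  show 2: "[s 2 = z * s 1 - s 0] (mod p)" using rec[of 0] by (simp add: numeral_2_eq_2)
  show 3: "[s 3 = (z^2 - 1) * s 1 - z * s 0] (mod p)"
    by (rule step[OF 2 cong_refl[of "s 1"]]) (simp_all add: algebra_simps power2_eq_square)
  show 4: "[s 4 = (z^3 - 2 * z) * s 1 - (z^2 - 1) * s 0] (mod p)"
    by (rule step[OF 3 2]) (simp_all add: algebra_simps eval_nat_numeral)
  show 5: "[s 5 = (z^4 - 3 * z^2 + 1) * s 1 - (z^3 - 2 * z) * s 0] (mod p)"
    by (rule step[OF 4 3]) (simp_all add: algebra_simps eval_nat_numeral)
  show 6: "[s 6 = (z^5 - 4 * z^3 + 3 * z) * s 1 - (z^4 - 3 * z^2 + 1) * s 0] (mod p)"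
    by (rule step[OF 5 4]) (simp_all add: algebra_simps eval_nat_numeral)
  show 7: "[s 7 = (z^6 - 5 * z^4 + 6 * z^2 - 1) * s 1 - (z^5 - 4 * z^3 + 3 * z) * s 0] (mod p)"
    by (rule step[OF 6 5]) (simp_all add: algebra_simps eval_nat_numeral)
qed

end

section \<open>Periodic points\<close>

lemma dvd_sum_two_squares:
  assumes p: "prime p" "p mod 4 = 3" and dvd: "int p dvd x\<^sup>2 + y\<^sup>2"
  shows   "int p dvd x" "int p dvd y"
proof -
  have pp: "prime (int p)" using p(1) by simp
  define j where "j = (p - 1) div 2"
  have "p = 4 * (p div 4) + 3" using p(2) by presburger
  hence j: "odd j" "p = 2 * j + 1" unfolding j_def by presburger+
  have "[x\<^sup>2 = - (y\<^sup>2)] (mod p)" using dvd by (simp add: cong_iff_dvd_diff)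
  hence "[(x\<^sup>2) ^ j = (- (y\<^sup>2)) ^ j] (mod p)" by (rule cong_pow)
  \<comment> \<open>Since \<open>j\<close> is odd the sign survives the power. The factor
    \<open>x * y\<close> raises both exponents to \<open>p\<close>, so Fermat's theorem applies
    without assuming \<open>x\<close> and \<open>y\<close> invertible, giving
    \<open>x * y = - x * y\<close> modulo \<open>p\<close>.\<close>
  hence "[x ^ (2 * j) * (x * y) = - (y ^ (2 * j)) * (x * y)] (mod p)"
    using j(1) by (intro cong_mult cong_refl) (simp add: power_mult)
  hence 1: "[x ^ p * y = - (y ^ p * x)] (mod p)" by (simp add: j(2) mult_ac)
  have "[x * y = x ^ p * y] (mod p)" by (intro cong_mult cong_refl cong_sym[OF fermat_int] p)
  also note 1
  also have "[- (y ^ p * x) = - (y * x)] (mod p)"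
    using cong_diff[OF cong_refl[of 0] cong_mult[OF fermat_int[OF p(1), of y] cong_refl[of x]]] by simp
  finally have "int p dvd 2 * (x * y)" by (simp add: cong_iff_dvd_diff algebra_simps)
  moreover have "\<not> int p dvd 2"
    using p by (auto dest!: zdvd_imp_le)
  ultimately have "int p dvd x \<or> int p dvd y" using pp by (metis prime_dvd_mult_iff)
  moreover have "int p dvd x \<longleftrightarrow> int p dvd y"
    using dvd pp by (metis dvd_add_right_iff dvd_add_left_iff prime_dvd_power_iff zero_less_numeral)
  ultimately show "int p dvd x" "int p dvd y" by auto
qed

lemma dvd_of_dvd_linear_system:
  fixes q :: int
  assumes q: "prime q" and dvd: "q dvd a * x + b * y" "q dvd c * x + d * y" and det: "\<not> q dvd a * d - b * c"
  shows   "q dvd x" "q dvd y"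
proof -
  have "q dvd d * (a * x + b * y) - b * (c * x + d * y)"
    using dvd by (intro dvd_diff[OF dvd_mult dvd_mult])
  also have "\<dots> = (a * d - b * c) * x" by (simp add: algebra_simps)
  finally show "q dvd x" using det q by (simp add: prime_dvd_mult_iff)
  have "q dvd a * (c * x + d * y) - c * (a * x + b * y)"
    using dvd by (intro dvd_diff[OF dvd_mult dvd_mult])
  also have "\<dots> = (a * d - b * c) * y" by (simp add: algebra_simps)
  finally show "q dvd y" using det q by (simp add: prime_dvd_mult_iff)
qed

context markoff_seq
begin

lemma prime_int: "prime (int p)"
  using prime by simp

text \<open>The conditions \<open>s 6 = s 0\<close> and \<open>s 7 = s 1\<close> form a homogeneous
  linear system in \<open>s 1\<close> and \<open>s 0\<close> with determinant
  \<open>(z\<^sup>2 - 1)\<^sup>2 * (z\<^sup>2 - 4)\<close>, which the hypotheses make invertible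
  modulo \<open>p\<close>.\<close>

lemma dvd_if_period_6:
  assumes per: "period 6" and z: "\<not> [z\<^sup>2 = 1] (mod p)" "\<not> [z\<^sup>2 = 4] (mod p)"
  shows   "int p dvd s 0" "int p dvd s 1"
proof -
  have per0: "[s 6 = s 0] (mod p)" and per1: "[s 7 = s 1] (mod p)"
    using per[unfolded period_def, rule_format, of 0] per[unfolded period_def, rule_format, of 1]
    by (simp_all add: eval_nat_numeral)
  let ?x = "s 1" and ?y = "s 0"
  define a b c where "a = z^5 - 4 * z^3 + 3 * z" and "b = - (z^4 - 3 * z^2 + 2)"
    and "c = z^6 - 5 * z^4 + 6 * z^2 - 2"
  have "[(z^5 - 4 * z^3 + 3 * z) * s 1 - (z^4 - 3 * z^2 + 1) * s 0 = s 0] (mod p)"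
    by (rule cong_trans[OF cong_sym[OF seq_values(5)] per0])
  hence 1: "int p dvd a * ?x + b * ?y"
    by (simp add: cong_iff_dvd_diff a_def b_def algebra_simps)
  have "[(z^6 - 5 * z^4 + 6 * z^2 - 1) * s 1 - (z^5 - 4 * z^3 + 3 * z) * s 0 = s 1] (mod p)"
    by (rule cong_trans[OF cong_sym[OF seq_values(6)] per1])
  hence 2: "int p dvd c * ?x + (- a) * ?y"
    by (simp add: cong_iff_dvd_diff a_def c_def algebra_simps)
  have det: "a * (- a) - b * c = (z\<^sup>2 - 1)\<^sup>2 * (z\<^sup>2 - 4)"
    by (simp add: a_def b_def c_def algebra_simps eval_nat_numeral)
  have "\<not> int p dvd (z\<^sup>2 - 1)\<^sup>2 * (z\<^sup>2 - 4)"
    using z prime_int by (auto simp: prime_dvd_mult_iff cong_iff_dvd_diff prime_dvd_power_iff)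
  hence nd: "\<not> int p dvd a * (- a) - b * c" using det by simp
  show "int p dvd ?x" "int p dvd ?y" using dvd_of_dvd_linear_system[OF prime_int 1 2 nd] by auto
qed

lemma dvd_if_period_4:
  assumes per: "period 4" and z: "\<not> [z = 0] (mod p)" "\<not> [z\<^sup>2 = 4] (mod p)"
  shows   "int p dvd s 0" "int p dvd s 1"
proof -
  have per0: "[s 4 = s 0] (mod p)" and per1: "[s 5 = s 1] (mod p)"
    using per[unfolded period_def, rule_format, of 0] per[unfolded period_def, rule_format, of 1]
    by (simp_all add: eval_nat_numeral)
  let ?x = "s 1" and ?y = "s 0"
  define a b c where "a = z^3 - 2 * z" and "b = - (z^2)" and "c = z^4 - 3 * z^2"
  have "[(z^3 - 2 * z) * s 1 - (z^2 - 1) * s 0 = s 0] (mod p)"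
    by (rule cong_trans[OF cong_sym[OF seq_values(3)] per0])
  hence 1: "int p dvd a * ?x + b * ?y"
    by (simp add: cong_iff_dvd_diff a_def b_def algebra_simps)
  have "[(z^4 - 3 * z^2 + 1) * s 1 - (z^3 - 2 * z) * s 0 = s 1] (mod p)"
    by (rule cong_trans[OF cong_sym[OF seq_values(4)] per1])
  hence 2: "int p dvd c * ?x + (- a) * ?y"
    by (simp add: cong_iff_dvd_diff a_def c_def algebra_simps)
  have det: "a * (- a) - b * c = z\<^sup>2 * (z\<^sup>2 - 4)"
    by (simp add: a_def b_def c_def algebra_simps eval_nat_numeral)
  have "\<not> int p dvd z\<^sup>2 * (z\<^sup>2 - 4)"
    using z prime_int by (auto simp: prime_dvd_mult_iff cong_iff_dvd_diff prime_dvd_power_iff)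
  hence nd: "\<not> int p dvd a * (- a) - b * c" using det by simp
  show "int p dvd ?x" "int p dvd ?y" using dvd_of_dvd_linear_system[OF prime_int 1 2 nd] by auto
qed

text \<open>For \<open>z = 2\<close> or \<open>z = -2\<close>, period 2 forces
  \<open>s 1 = s 0\<close> or \<open>s 1 = - s 0\<close>, respectively. The surface equation then
  reduces to \<open>z\<^sup>2 = 0\<close>, against \<open>z\<^sup>2 = 4\<close> and \<open>p\<close>
  odd.\<close>

lemma not_period_2_degenerate:
  assumes per: "period 2" and z: "[z\<^sup>2 = 4] (mod p)"
    and surface: "[s 1 ^ 2 + s 0 ^ 2 + z ^ 2 = s 1 * s 0 * z] (mod p)"
  shows   False
proof -
  have per0: "[s 2 = s 0] (mod p)" and per1: "[s 3 = s 1] (mod p)"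
    using per[unfolded period_def, rule_format, of 0] per[unfolded period_def, rule_format, of 1]
    by (simp_all add: eval_nat_numeral)
  let ?x = "s 1" and ?y = "s 0"
  define e1 e2 e3 e4 where "e1 = z * ?x - 2 * ?y" and "e2 = z * ?y - 2 * ?x"
    and "e3 = z\<^sup>2 - 4" and "e4 = ?x\<^sup>2 + ?y\<^sup>2 + z\<^sup>2 - ?x * ?y * z"
  have "[z * s 1 - s 0 = s 0] (mod p)"
    by (rule cong_trans[OF cong_sym[OF seq_values(1)] per0])
  hence 1: "int p dvd e1" by (simp add: cong_iff_dvd_diff e1_def algebra_simps)
  have "[(z^2 - 1) * s 1 - z * s 0 = s 1] (mod p)"
    by (rule cong_trans[OF cong_sym[OF seq_values(2)] per1])
  hence "int p dvd (z\<^sup>2 - 4) * ?x - e2 " by (simp add: cong_iff_dvd_diff e2_def algebra_simps)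
  moreover have 3: "int p dvd e3" using z by (simp add: cong_iff_dvd_diff e3_def)
  ultimately have 2: "int p dvd e2" unfolding e3_def by (metis dvd_diff_right_iff dvd_mult2)
  have 4: "int p dvd e4" using surface by (simp add: cong_iff_dvd_diff e4_def)
  \<comment> \<open>An explicit combination of the four vanishing expressions that equals 16, which
    avoids separating the two signs of \<open>z\<close>.\<close>
  have "int p dvd 4 * e4 + 4 * ?x * e2 - ?x\<^sup>2 * e3 + 2 * z * ?x * e1 - e1 * e1 - 4 * e3"
    using 1 2 3 4 by (intro dvd_diff dvd_add dvd_mult) auto
  also have "\<dots> = 2 ^ 4"
    by (simp add: e1_def e2_def e3_def e4_def algebra_simps eval_nat_numeral)
  finally have "int p dvd 2" using prime_int prime_dvd_power by blast
  thus False using odd by (auto dest: zdvd_imp_le)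
qed

lemma no_periodic_point:
  assumes p: "p mod 4 = 3" "\<not> p dvd n"
    and d6: "\<And>d. d dvd 2 * n \<Longrightarrow> d dvd p - 1 \<Longrightarrow> d dvd 6"
    and d4: "\<And>d. d dvd 2 * n \<Longrightarrow> d dvd p + 1 \<Longrightarrow> d dvd 4"
    and surface: "[s 1 ^ 2 + s 0 ^ 2 + z ^ 2 = s 1 * s 0 * z] (mod p)"
    and z: "\<not> [z\<^sup>2 = 1] (mod p)"
    and nz: "\<not> (int p dvd s 1 \<and> int p dvd s 0 \<and> int p dvd z)"
    and per: "[s (2 * n) = s 0] (mod p)" "[s (2 * n + 1) = s 1] (mod p)"
  shows   False
proof -
  have per: "period (2 * n)" by (rule period_if[OF per])
  \<comment> \<open>If both initial values vanish, the surface equation gives \<open>z = 0\<close>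
    as well, so the point would be the origin.\<close>
  have nd: False if "int p dvd s 0" "int p dvd s 1"
  proof -
    have "int p dvd s 1 * s 0 * z - s 1 ^ 2 - s 0 ^ 2"
      using that by (intro dvd_diff) (auto simp: power2_eq_square)
    also have "\<dots> = z\<^sup>2 - (s 1 ^ 2 + s 0 ^ 2 + z ^ 2 - s 1 * s 0 * z)" by simp
    finally have "int p dvd z\<^sup>2"
      using surface by (simp only: cong_iff_dvd_diff dvd_diff_left_iff)
    hence "int p dvd z" using prime_int prime_dvd_power by blast
    with nz that show False by blast
  qed
  show False
  proof (cases rule: period_cases)
    case minus
    hence "period (p - 1)" by (simp add: period_def)
    hence "period (gcd (2 * n) (p - 1))" using per by (intro period_gcd)
    moreover have "gcd (2 * n) (p - 1) dvd 6" by (intro d6) auto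
    ultimately have "period 6" by (rule period_dvd)
    thus False using dvd_if_period_6[OF _ z minus(1)] nd by blast
  next
    case plus
    hence "period (p + 1)" by (simp add: period_def)
    hence "period (gcd (2 * n) (p + 1))" using per by (intro period_gcd)
    moreover have "gcd (2 * n) (p + 1) dvd 4" by (intro d4) auto
    ultimately have 4: "period 4" by (rule period_dvd)
    show False
    \<comment> \<open>For \<open>z = 0\<close> the period-4 determinant vanishes, but the surface
      equation becomes a sum of two squares.\<close>
    proof (cases "[z = 0] (mod p)")
      case True
      hence "int p dvd z" by (simp add: cong_0_iff)
      hence "int p dvd z\<^sup>2 - s 1 * s 0 * z" by (simp add: power2_eq_square)
      moreover have "int p dvd s 1 ^ 2 + s 0 ^ 2 + (z\<^sup>2 - s 1 * s 0 * z)"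
        using surface by (simp add: cong_iff_dvd_diff algebra_simps)
      ultimately have "int p dvd s 1 ^ 2 + s 0 ^ 2" by (simp only: dvd_add_left_iff)
      from dvd_sum_two_squares[OF prime p(1) this] show False using nd by blast
    next
      case False
      show False using dvd_if_period_4[OF 4 False plus(1)] nd by blast
    qed
  next
    case degenerate
    hence "period (2 * p)" by (simp add: period_def)
    hence "period (gcd (2 * n) (2 * p))" using per by (intro period_gcd)
    moreover have "gcd n p = 1" using p(2) prime
      by (metis coprime_iff_gcd_eq_1 gcd.commute prime_imp_coprime)
    ultimately have "period 2" by (simp add: gcd_mult_distrib_nat[symmetric])
    thus False using not_period_2_degenerate degenerate(1) surface by blast
  qed
qed

end

text \<open>The second coordinate is the term of index 0 and the first that of index 1; one
  application of the map advances both by two steps. Reduction starts at index 2, so the initial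
  terms are kept literally and later ones are the representatives used by
  \<open>residue_ring\<close>.\<close>

fun linear_rec_mod :: "int \<Rightarrow> int \<Rightarrow> int \<Rightarrow> int \<Rightarrow> nat \<Rightarrow> int" where
  "linear_rec_mod m z y x 0 = y"
| "linear_rec_mod m z y x (Suc 0) = x"
| "linear_rec_mod m z y x (Suc (Suc k)) = (z * linear_rec_mod m z y x (Suc k) - linear_rec_mod m z y x k) mod m"

lemma funpow_markoff_map:
  assumes m: "m > 1"
  shows "(markoff_map (residue_ring m) ^^ n) (x, y, z) =
           (linear_rec_mod m z y x (2 * n + 1), linear_rec_mod m z y x (2 * n), z)"
proof (induction n)
  case (Suc n)
  interpret residues m "residue_ring m" by unfold_locales (use m in auto)
  show ?case using Suc
    by (simp add: markoff_map_def phi1_def phi2_def a_minus_def res_neg_eq res_add_eq res_mult_eq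
      mod_simps mult.commute)
qed simp

section \<open>Choice of the prime and conclusion\<close>

lemma exists_residue_class:
  obtains a N :: nat where "N > 0" "coprime a N"
    "\<And>p. [p = a] (mod N) \<Longrightarrow> p mod 72 = 67 \<and> (\<forall>q. prime q \<longrightarrow> 5 \<le> q \<longrightarrow> q \<le> K \<longrightarrow> [p = 2] (mod q))"
proof -
  let ?Q = "{q. prime q \<and> 5 \<le> q \<and> q \<le> K}"
  define A where "A = insert 72 ?Q"
  \<comment> \<open>The residue 67 modulo 72 means 3 modulo 8 and 4 modulo 9: then
    \<open>p - 1\<close> contains 2 and 3 exactly once each, while \<open>p + 1\<close> contains 2
    exactly twice and is prime to 3. The residue 2 modulo \<open>q \<ge> 5\<close> keeps
    \<open>q\<close> out of both \<open>p - 1\<close> and \<open>p + 1\<close>.\<close>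
  define u where "u i = (if i = 72 then 67 else 2 :: nat)" for i :: nat
  have fin: "finite A" by (auto simp: A_def)
  have cop72: "coprime 72 q" if "q \<in> ?Q" for q
  proof -
    have "\<not> q dvd 2" "\<not> q dvd 3" using that by (auto dest: dvd_imp_le)
    hence "\<not> q dvd 2 ^ 3 * 3 ^ 2" using that by (metis (mono_tags) mem_Collect_eq prime_dvd_mult_iff prime_dvd_power)
    thus ?thesis using that prime_imp_coprime[of q 72] by (simp add: coprime_commute)
  qed
  have cop: "\<forall>i\<in>A. \<forall>j\<in>A. i \<noteq> j \<longrightarrow> coprime i j"
    using cop72 by (auto simp: A_def coprime_commute primes_coprime)
  obtain a where a: "\<And>i. i \<in> A \<Longrightarrow> [a = u i] (mod i)"
    using chinese_remainder_nat[OF fin cop, of u] by blast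
  have "coprime (u i) i" if "i \<in> A" for i
  proof (cases "i = 72")
    case True
    have "coprime (67::nat) 72" by (simp add: coprime_iff_gcd_eq_1 gcd_non_0_nat)
    thus ?thesis by (simp add: True u_def)
  next
    case False
    hence i: "i \<in> ?Q" using that by (auto simp: A_def)
    hence "odd i" using prime_odd_nat[of i] by auto
    thus ?thesis using False by (simp add: u_def)
  qed
  hence "coprime a i" if "i \<in> A" for i using a[OF that] that coprime_cong_nat by blast
  hence copa: "coprime a (\<Prod>A)" by (intro prod_coprime_right) auto
  show ?thesis
  proof (rule that[OF _ copa])
    show "\<Prod>A > 0" using fin by (auto simp: A_def prime_gt_0_nat intro!: prod_pos)
    fix p assume "[p = a] (mod \<Prod>A)"
    hence *: "[p = u i] (mod i)" if "i \<in> A" for i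
      using a[OF that] that fin by (metis cong_dvd_modulus_nat cong_trans dvd_prodI)
    have "p mod 72 = 67" using *[of 72] by (simp add: A_def u_def cong_def)
    moreover have "[p = 2] (mod q)" if "prime q" "5 \<le> q" "q \<le> K" for q
    proof -
      have "q \<noteq> 72" using cop72[of q] that by auto
      thus ?thesis using *[of q] that by (simp add: A_def u_def)
    qed
    ultimately show "p mod 72 = 67 \<and> (\<forall>q. prime q \<longrightarrow> 5 \<le> q \<longrightarrow> q \<le> K \<longrightarrow> [p = 2] (mod q))" by blast
  qed
qed

text \<open>Here \<open>p - 1 = 6 * k\<close> or \<open>p + 1 = 4 * k\<close> with \<open>k\<close>
  prime to 6. A prime common to \<open>d\<close> and \<open>k\<close> would be at least 5 and at
  most \<open>K\<close>, where \<open>p\<close> is 2 modulo it; so \<open>d\<close> is coprime to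
  \<open>k\<close>.\<close>

lemma dvd_6_or_4:
  fixes p d K :: nat
  assumes p: "p mod 72 = 67" and q: "\<And>q. prime q \<Longrightarrow> 5 \<le> q \<Longrightarrow> q \<le> K \<Longrightarrow> [p = 2] (mod q)"
    and d: "0 < d" "d \<le> K"
  shows "d dvd p - 1 \<Longrightarrow> d dvd 6" "d dvd p + 1 \<Longrightarrow> d dvd 4"
proof -
  define t where "t = p div 72"
  have t: "p = 72 * t + 67" using p by (metis mult_div_mod_eq t_def)
  have ge5: "r \<ge> 5" if "prime r" "\<not> 2 dvd k" "\<not> 3 dvd k" "r dvd k" for r k :: nat
  proof -
    have "r \<noteq> 0" "r \<noteq> 1" "r \<noteq> 2" "r \<noteq> 3" "r \<noteq> 4" using that by (auto simp: prime_nat_numeral_eq)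
    thus ?thesis by linarith
  qed
  show "d dvd 6" if "d dvd p - 1"
  proof -
    define k where "k = 12 * t + 11"
    have k: "p - 1 = 6 * k" by (simp add: k_def t)
    have k23: "\<not> 2 dvd k" "\<not> 3 dvd k" unfolding k_def by presburger+
    have "coprime d k"
    proof (rule ccontr)
      assume "\<not> coprime d k"
      then obtain r where r: "prime r" "r dvd d" "r dvd k"
        using prime_factor_nat[of "gcd d k"] unfolding coprime_iff_gcd_eq_1 by (metis gcd_greatest_iff)
      have "r \<le> K" using r(2) d by (meson dvd_imp_le order.trans)
      hence "[p = 2] (mod r)" using ge5[OF r(1) k23 r(3)] q r by blast
      moreover have "[p = 1] (mod r)" using r(3) k t by (simp add: cong_altdef_nat)
      ultimately have "[1 = 2] (mod r)" by (meson cong_sym cong_trans)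
      thus False using ge5[OF r(1) k23 r(3)] by (simp add: cong_def)
    qed
    thus ?thesis using that unfolding k by (simp add: coprime_dvd_mult_left_iff)
  qed
  show "d dvd 4" if "d dvd p + 1"
  proof -
    define k where "k = 18 * t + 17"
    have k: "p + 1 = 4 * k" by (simp add: k_def t)
    have k23: "\<not> 2 dvd k" "\<not> 3 dvd k" unfolding k_def by presburger+
    have "coprime d k"
    proof (rule ccontr)
      assume "\<not> coprime d k"
      then obtain r where r: "prime r" "r dvd d" "r dvd k"
        using prime_factor_nat[of "gcd d k"] unfolding coprime_iff_gcd_eq_1 by (metis gcd_greatest_iff)
      have "r \<le> K" using r(2) d by (meson dvd_imp_le order.trans)
      hence "[p = 2] (mod r)" using ge5[OF r(1) k23 r(3)] q r by blast
      hence "[p + 1 = 2 + 1] (mod r)" by (intro cong_add cong_refl)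
      moreover have "[p + 1 = 0] (mod r)" using r(3) k by (simp add: cong_0_iff)
      ultimately have "[3 = 0] (mod r)" by (simp add: cong_def)
      thus False using ge5[OF r(1) k23 r(3)] by (auto simp: cong_0_iff dest: dvd_imp_le)
    qed
    thus ?thesis using that unfolding k by (simp add: coprime_dvd_mult_left_iff)
  qed
qed

theorem theorem1p3:
  "\<not> strongly_residually_periodic markoff_surface markoff_map forbidden_set2"
proof
  assume "strongly_residually_periodic markoff_surface markoff_map forbidden_set2"
  then obtain B :: nat and S :: "nat set" where BS: "finite S"
    "\<And>p. prime p \<Longrightarrow> p \<notin> S \<Longrightarrow>
        (\<exists>P \<in> markoff_surface (residue_ring (int p)) - forbidden_set2 (residue_ring (int p)).
          \<exists>n. 1 \<le> n \<and> n \<le> B \<and> (markoff_map (residue_ring (int p)) ^^ n) P = P)"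
    unfolding strongly_residually_periodic_def by blast
  obtain a N :: nat where aN: "N > 0" "coprime a N"
    "\<And>p. [p = a] (mod N) \<Longrightarrow> p mod 72 = 67 \<and> (\<forall>q. prime q \<longrightarrow> 5 \<le> q \<longrightarrow> q \<le> 2 * B \<longrightarrow> [p = 2] (mod q))"
    by (rule exists_residue_class[of "2 * B"], rule that)
  \<comment> \<open>Removing \<open>{..B}\<close> as well makes \<open>p\<close> exceed every
    admissible \<open>n\<close>, so \<open>p\<close> does not divide \<open>n\<close>.\<close>
  have "infinite ({p. prime p \<and> [p = a] (mod N)} - (S \<union> {..B}))"
    using dirichlet_infinite_primes[OF aN(1,2)] BS(1) by (intro Diff_infinite_finite) auto
  then obtain p where "p \<in> {p. prime p \<and> [p = a] (mod N)} - (S \<union> {..B})"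
    using infinite_imp_nonempty by blast
  hence p: "prime p" "[p = a] (mod N)" "p \<notin> S" "p > B" by auto
  have p72: "p mod 72 = 67" and q: "\<And>q. prime q \<Longrightarrow> 5 \<le> q \<Longrightarrow> q \<le> 2 * B \<Longrightarrow> [p = 2] (mod q)"
    using aN(3)[OF p(2)] by auto
  have p4: "p mod 4 = 3" using p72 by presburger
  have "p > 2" using p72 by presburger
  interpret R: residues "int p" "residue_ring (int p)"
    by unfold_locales (use \<open>p > 2\<close> in auto)
  obtain x y z n where P: "(x, y, z) \<in> markoff_surface (residue_ring (int p))"
    "(x, y, z) \<notin> forbidden_set2 (residue_ring (int p))" "1 \<le> n" "n \<le> B"
    "(markoff_map (residue_ring (int p)) ^^ n) (x, y, z) = (x, y, z)"
    using BS(2)[OF p(1,3)] by auto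
  have range: "x \<in> {0..int p - 1}" "y \<in> {0..int p - 1}" "z \<in> {0..int p - 1}"
    using P(1) by (auto simp: markoff_surface_def R.res_carrier_eq)
  have pow: "v [^]\<^bsub>residue_ring (int p)\<^esub> (2::nat) = v ^ 2 mod p" if "v \<in> {0..int p - 1}" for v
    using R.pow_cong[of v 2] that by simp
  define s where "s = linear_rec_mod p z y x"
  interpret markoff_seq p z s
    by unfold_locales (use p(1) \<open>p > 2\<close> in \<open>auto simp: s_def cong_def\<close>)
  have s: "s 0 = y" "s 1 = x" "s (2 * n) = y" "s (2 * n + 1) = x"
    using P(5) funpow_markoff_map[of "int p" n x y z] \<open>p > 2\<close> by (auto simp: s_def)
  \<comment> \<open>The sequence has period \<open>2 * n\<close>, so the divisors concerned are at
    most \<open>2 * B\<close>, the bound used when choosing the residue class.\<close>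
  have le: "0 < d" "d \<le> 2 * B" if "d dvd 2 * n" for d
    using dvd_imp_le[OF that] dvd_pos_nat[OF _ that] P(3,4) by simp_all
  show False
  proof (rule no_periodic_point[OF p4, of n])
    show "\<not> p dvd n" using P(3,4) p(4) by (auto dest: dvd_imp_le)
    show "d dvd 6" if "d dvd 2 * n" "d dvd p - 1" for d
      by (rule dvd_6_or_4(1)[OF p72 q le[OF that(1)] that(2)])
    show "d dvd 4" if "d dvd 2 * n" "d dvd p + 1" for d
      by (rule dvd_6_or_4(2)[OF p72 q le[OF that(1)] that(2)])
    show "[s 1 ^ 2 + s 0 ^ 2 + z ^ 2 = s 1 * s 0 * z] (mod p)"
    proof -
      have "(x\<^sup>2 + y\<^sup>2 + z\<^sup>2) mod int p = (x\<^sup>2 mod int p + y\<^sup>2 mod int p + z\<^sup>2) mod int p"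
        by (intro mod_add_cong) simp_all
      thus ?thesis using P(1) range unfolding s
        by (simp add: markoff_surface_def pow R.res_add_eq R.res_mult_eq mod_simps cong_def)
    qed
    show "\<not> [z\<^sup>2 = 1] (mod p)"
    proof
      assume "[z\<^sup>2 = 1] (mod p)"
      hence "(z\<^sup>2 - 1) mod p = 0" by (simp add: cong_iff_dvd_diff)
      hence "(x, y, z) \<in> forbidden_set2 (residue_ring (int p))"
        using P(1) range(3) by (simp add: forbidden_set2_def pow R.res_one_eq R.res_zero_eq a_minus_def
          R.res_neg_eq R.res_add_eq mod_simps)
      with P(2) show False by blast
    qed
    show "\<not> (int p dvd s 1 \<and> int p dvd s 0 \<and> int p dvd z)"
    proof
      assume "int p dvd s 1 \<and> int p dvd s 0 \<and> int p dvd z"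
      hence "x = 0" "y = 0" "z = 0"
        using range unfolding s by (auto dest!: zdvd_not_zless[rotated 1] simp: dvd_eq_mod_eq_0)
      with P(2) show False by (simp add: forbidden_set2_def R.res_zero_eq)
    qed
  qed (use s in auto)
qed

end
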